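(* Let $G:\mathbb B^n\to\mathbb C^n$ be an infinitesimal generator. Suppose that $(\ast)$ the function $z\mapsto |\langle G(z),e_1\rangle|/|z_1-1|$ is bounded on every Korányi region $K(e_1,R)$, $R\ge 1$, and $(\ast\ast)$ for each $j=2,\dots,n$ the function $z\mapsto |\langle G(z),e_j\rangle|/|z_1-1|^{1/2}$ is bounded on every Korányi region $K(e_1,R)$, $R\geq 1$. Then $e_1$ is a boundary regular null point for $G$. Moreover, if $\beta\in\mathbb R$ denotes the dilation of $G$ at $e_1$, then: (1') $\langle dG_z(e_1),e_1\rangle$ and $\langle dG_z(e_h),e_k\rangle$ ($h,k=2,\dots,n$) are bounded on every Korányi region; (1'') $\langle dG_z(e_j),e_1\rangle/(1-z_1)^{1/2}$ is bounded on every Korányi region for $j=2,\dots,n$; (1''') $(1-z_1)^{1/2}\langle dG_z(e_1),e_j\rangle$ is bounded on every Korányi region for $j=2,\dots,n$; (2) $\angle_K\lim_{z\to e_1}\frac{\langle G(z),e_1\rangle}{z_1-1}=\beta$; (3) $\angle_K\lim_{z\to e_1}\langle dG_z(e_1),e_1\rangle=\beta$; (4) $\angle_K\lim_{z\to e_1}\langle dG_z(e_j),e_1\rangle=0$ for $j=2,\dots,n$.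
   Context: $\mathbb B^n$ is the open unit ball of $\mathbb C^n$, $\mathbb D$ the unit disc, $\langle z,w\rangle=\sum_j z_j\overline{w_j}$, $\{e_1,\dots,e_n\}$ the standard basis; $z=(z_1,z'')\in\mathbb C\times\mathbb C^{n-1}$. $(1-z_1)^{1/2}$ denotes the principal branch. A holomorphic map $G:\mathbb B^n\to\mathbb C^n$ is an infinitesimal generator if for every $z_0\in\mathbb B^n$ the Cauchy problem $\dot x(t)=G(x(t))$, $x(0)=z_0$, has a solution $x:[0,+\infty)\to\mathbb B^n$. Korányi region: for $R\ge1$, $K(e_1,R)=\{z\in\mathbb B^n:|1-z_1|\le\frac R2(1-\|z\|^2)\}$. Restricted $K$-limit: $\angle_K\lim_{z\to e_1}f(z)=L$ means that for every sequence $z_k\in\mathbb B^n$ with $z_k\to e_1$, $\|z_k-\langle z_k,e_1\rangle e_1\|^2/(1-|\langle z_k,e_1\rangle|^2)\to0$ and $\langle z_k,e_1\rangle\to1$ non-tangentially in $\mathbb D$, one has $f(z_k)\to L$. Let $u_{\mathbb B^n}(z)=-\frac{1-\|z\|^2}{|1-z_1|^2}$ and, for $w\in\mathbb C^n$, $d(u_{\mathbb B^n})_z\cdot w=\frac{d}{dt}\big|_{t=0}u_{\mathbb B^n}(z+tw)$ ($t$ real). The point $e_1$ is a boundary regular null point (BRNP) of the infinitesimal generator $G$ if there is $b\in\mathbb R$ with $d(u_{\mathbb B^n})_z\cdot G(z)+b\,u_{\mathbb B^n}(z)\le0$ for all $z\in\mathbb B^n$; then the dilation of $G$ at $e_1$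 is $\beta:=-\inf_{z\in\mathbb B^n}\frac{d(u_{\mathbb B^n})_z\cdot G(z)}{u_{\mathbb B^n}(z)}\in\mathbb R$. *)

theory Defs
  imports "HOL-Analysis.Analysis"
begin

text \<open>C^n is modelled as complex ^ 'n for a finite index type 'n; the distinguished
  coordinate playing the role of index 1 is a parameter a :: 'n.\<close>

definition cinner :: "complex ^ 'n::finite \<Rightarrow> complex ^ 'n \<Rightarrow> complex" where
  "cinner z w = (\<Sum>j\<in>UNIV. z $ j * cnj (w $ j))"

definition cbasis :: "'n::finite \<Rightarrow> complex ^ 'n" where
  "cbasis k = axis k 1"

definition holomorphic_vec_on :: "(complex ^ 'n::finite \<Rightarrow> complex ^ 'm::finite) \<Rightarrow> (complex ^ 'n) set \<Rightarrow> bool" where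
  "holomorphic_vec_on G S \<longleftrightarrow>
     (\<forall>z\<in>S. \<exists>L. (G has_derivative L) (at z) \<and> (\<forall>c w. L (c *s w) = c *s L w))"

definition infinitesimal_generator :: "(complex ^ 'n::finite \<Rightarrow> complex ^ 'n) \<Rightarrow> bool" where
  "infinitesimal_generator G \<longleftrightarrow>
     holomorphic_vec_on G (ball 0 1) \<and>
     (\<forall>z0\<in>ball 0 1. \<exists>x :: real \<Rightarrow> complex ^ 'n.
        x 0 = z0 \<and> (\<forall>t\<ge>0. x t \<in> ball 0 1) \<and>
        (\<forall>t\<ge>0. (x has_vector_derivative G (x t)) (at t within {0..})))"

definition koranyi :: "'n::finite \<Rightarrow> real \<Rightarrow> (complex ^ 'n) set" where
  "koranyi a R = {z \<in> ball 0 1. cmod (1 - z $ a) \<le> R / 2 * (1 - (norm z)\<^sup>2)}"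

definition bounded_on_koranyi :: "'n::finite \<Rightarrow> (complex ^ 'n \<Rightarrow> real) \<Rightarrow> bool" where
  "bounded_on_koranyi a f \<longleftrightarrow> (\<forall>R\<ge>1. \<exists>M. \<forall>z\<in>koranyi a R. \<bar>f z\<bar> \<le> M)"

definition nontangential_to_one :: "(nat \<Rightarrow> complex) \<Rightarrow> bool" where
  "nontangential_to_one w \<longleftrightarrow> w \<longlonglongrightarrow> 1 \<and> (\<exists>M. \<forall>k. cmod (1 - w k) \<le> M * (1 - cmod (w k)))"

definition restricted_K_limit :: "'n::finite \<Rightarrow> (complex ^ 'n \<Rightarrow> complex) \<Rightarrow> complex \<Rightarrow> bool" where
  "restricted_K_limit a f L \<longleftrightarrow>
     (\<forall>zs :: nat \<Rightarrow> complex ^ 'n.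
        (\<forall>k. zs k \<in> ball 0 1) \<and> zs \<longlonglongrightarrow> cbasis a \<and>
        (\<lambda>k. (norm (zs k - cinner (zs k) (cbasis a) *s cbasis a))\<^sup>2
              / (1 - (cmod (cinner (zs k) (cbasis a)))\<^sup>2)) \<longlonglongrightarrow> 0 \<and>
        nontangential_to_one (\<lambda>k. cinner (zs k) (cbasis a))
        \<longrightarrow> (\<lambda>k. f (zs k)) \<longlonglongrightarrow> L)"

definition u_ball :: "'n::finite \<Rightarrow> complex ^ 'n \<Rightarrow> real" where
  "u_ball a z = - (1 - (norm z)\<^sup>2) / (cmod (1 - z $ a))\<^sup>2"

definition du_ball :: "'n::finite \<Rightarrow> complex ^ 'n \<Rightarrow> complex ^ 'n \<Rightarrow> real" where
  "du_ball a z w = deriv (\<lambda>t::real. u_ball a (z + t *\<^sub>R w)) 0"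

definition BRNP :: "'n::finite \<Rightarrow> (complex ^ 'n \<Rightarrow> complex ^ 'n) \<Rightarrow> bool" where
  "BRNP a G \<longleftrightarrow> (\<exists>b::real. \<forall>z\<in>ball 0 1. du_ball a z (G z) + b * u_ball a z \<le> 0)"

definition dilation :: "'n::finite \<Rightarrow> (complex ^ 'n \<Rightarrow> complex ^ 'n) \<Rightarrow> real" where
  "dilation a G = - (INF z\<in>ball 0 1. du_ball a z (G z) / u_ball a z)"

definition dG :: "(complex ^ 'n::finite \<Rightarrow> complex ^ 'n) \<Rightarrow> complex ^ 'n \<Rightarrow> complex ^ 'n \<Rightarrow> complex ^ 'n" where
  "dG G z w = frechet_derivative G (at z) w"

end

theory Submission
  imports Defs "HOL-Complex_Analysis.Riemann_Mapping"
begin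

text \<open>
  The flow of \<open>G\<close> is a limit of Euler polygons, which are holomorphic in the initial point, so it obeys the
  Schwarz--Pick inequality on the affine disc through two given points \<open>z\<close>, \<open>w\<close>. Differentiating at time
  \<open>0\<close> gives
  \<open>Re \<langle>G z,z\<rangle>/(1-|z|\<^sup>2) + Re \<langle>G w,w\<rangle>/(1-|w|\<^sup>2) \<le> Re ((\<langle>G z,w\<rangle> + \<langle>z,G w\<rangle>)/(1-\<langle>z,w\<rangle>))\<close>.
  For \<open>w = r e\<^sub>1\<close> and \<open>r \<rightarrow> 1\<close>, where \<open>G(r e\<^sub>1) \<rightarrow> 0\<close> by hypothesis, this bounds \<open>du(G)/u\<close> at every \<open>z\<close>
  from below by the upper limit of \<open>-Re G\<^sub>1(r e\<^sub>1)/(r-1)\<close>. Hence \<open>e\<^sub>1\<close> is a boundary regular null point;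
  evaluating \<open>du(G)/u\<close> at \<open>z = r e\<^sub>1\<close> shows that \<open>Re G\<^sub>1(r e\<^sub>1)/(r-1)\<close> tends to \<open>\<beta>\<close>.
  On the slice, \<open>P(\<zeta>) = G\<^sub>1(\<zeta> e\<^sub>1)/(1-\<zeta>)\<^sup>2 + (\<beta>/2)(1+\<zeta>)/(1-\<zeta>)\<close> has nonnegative real part, and Schwarz--Pick for
  the half-plane turns the radial limit into a non-tangential one. Cauchy estimates on polydiscs of radii
  comparable to \<open>|1-z\<^sub>1|\<close> and \<open>|1-z\<^sub>1|\<^bsup>1/2\<^esup>\<close> give the bounds for \<open>dG\<close> and carry the limits from the slice
  to restricted sequences.
\<close>

section \<open>The Hermitian product and the Schwarz--Pick lemma\<close>

text \<open>The obstacle is that the hypotheses control \<open>G\<close> only up to constants: no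
  radial limit is assumed, and nothing is said about how a trajectory depends on its starting point.
  An Euler polygon is an explicit composition of holomorphic maps, and the existence of trajectories
  for all positive times keeps the polygons over a compact set inside the ball once the steps are
  short. Schwarz--Pick can then be used before the limit is taken. The hypothesis on the tangential
  components enters twice: in the cross term \<open>\<langle>z,G w\<rangle>\<close>, which sees
  every component of \<open>G\<close> on the radius, and in the derivatives of these components. The
  two radii reflect the geometry of the ball: the squared norm of the tangential part is below
  \<open>1-|z\<^sub>1|\<^sup>2\<close>, hence of order \<open>|1-z\<^sub>1|\<close>. A displacement
  across the slice may therefore be as long as the square root of \<open>|1-z\<^sub>1|\<close>
  before the norm changes by more than a multiple of \<open>|1-z\<^sub>1|\<close>. Every derivative
  bound is the size of a component of \<open>G\<close> divided by one of the two radii.\<close>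

lemma cinner_cbasis [simp]: "cinner z (cbasis a) = z $ a"
  by (simp add: cinner_def cbasis_def axis_def if_distrib [of cnj] if_distrib [of "times _"] cong: if_cong)

lemma Re_cinner: "Re (cinner z w) = z \<bullet> w"
  by (simp add: cinner_def inner_vec_def inner_complex_def)

lemma cinner_add_left: "cinner (x + y) w = cinner x w + cinner y w"
  by (simp add: cinner_def algebra_simps sum.distrib)

lemma cinner_diff_left: "cinner (x - y) w = cinner x w - cinner y w"
  by (simp add: cinner_def algebra_simps sum_subtractf)

lemma cinner_scale_left: "cinner (c *s x) w = c * cinner x w"
  by (simp add: cinner_def sum_distrib_left mult.assoc)

lemma cinner_cnj: "cnj (cinner z w) = cinner w z"
  by (simp add: cinner_def mult.commute)

lemma cinner_add_right: "cinner w (x + y) = cinner w x + cinner w y"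
  by (simp add: cinner_def algebra_simps sum.distrib)

lemma cinner_scale_right: "cinner x (c *s w) = cnj c * cinner x w"
  by (simp add: cinner_def sum_distrib_left mult_ac)

lemma cinner_self: "cinner z z = of_real ((norm z)\<^sup>2)"
proof -
  have "cnj (cinner z z) = cinner z z" by (rule cinner_cnj)
  then have "Im (cinner z z) = 0"
    by (simp add: complex_eq_iff)
  then show ?thesis
    by (simp add: complex_eq_iff Re_cinner power2_norm_eq_inner)
qed

lemma norm_scale_vec: "norm (c *s (x :: complex ^ 'n::finite)) = cmod c * norm x"
  by (simp add: norm_vec_def L2_set_def norm_mult power_mult_distrib sum_distrib_left [symmetric] real_sqrt_mult)

lemma scaleR_eq_scale_vec: "r *\<^sub>R (x :: complex ^ 'n::finite) = of_real r *s x"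
  by (simp add: vec_eq_iff scaleR_conv_of_real[symmetric])

text \<open>A unimodular factor \<open>u\<close> rotates the product onto the nonnegative real axis,
  where it is a real inner product and the real inequality applies.\<close>

lemma cinner_Cauchy_Schwarz: "cmod (cinner x y) \<le> norm x * norm y"
proof -
  define c where "c = cinner x y"
  define u where "u = (if c = 0 then 1 else cnj c / of_real (cmod c))"
  have u: "cmod u = 1" by (auto simp: u_def norm_divide)
  have "u * c = of_real (cmod c)"
  proof (cases "c = 0")
    case False
    have "u * c = (c * cnj c) / of_real (cmod c)" using False by (simp add: u_def)
    also have "\<dots> = of_real (cmod c)"
      using False by (subst complex_norm_square [symmetric]) (simp add: power2_eq_square)
    finally show ?thesis .
  qed simp
  then have "cmod c = Re (cinner (u *s x) y)"
    by (simp add: cinner_scale_left c_def)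
  also have "\<dots> \<le> norm (u *s x) * norm y"
    unfolding Re_cinner by (rule norm_cauchy_schwarz)
  finally show ?thesis by (simp add: c_def norm_scale_vec u)
qed

lemma bounded_linear_cinner: "bounded_linear (\<lambda>x. cinner x w)"
  by (rule bounded_linear_intro [where K = "norm w"])
    (auto simp: cinner_add_left cinner_scale_left scaleR_eq_scale_vec scaleR_conv_of_real cinner_Cauchy_Schwarz)

text \<open>Divided by \<open>(cmod (1 - cnj b * a))\<^sup>2\<close>, this is the formula for one
  minus the squared pseudohyperbolic distance. It frees Schwarz--Pick from quotients.\<close>

lemma norm_diff_sq_identity:
  "(cmod (1 - cnj b * a))\<^sup>2 - (cmod (a - b))\<^sup>2 = (1 - (cmod a)\<^sup>2) * (1 - (cmod b)\<^sup>2)"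
  unfolding cmod_power2 by (simp add: algebra_simps power2_eq_square)

text \<open>Disc automorphisms carry \<open>b\<close> and \<open>f b\<close> to \<open>0\<close>,
  and the Schwarz lemma applies to the composite \<open>g\<close>. The conclusion is squared and
  cleared of denominators because it is later multiplied out, passed to a limit and
  differentiated.\<close>

theorem Schwarz_Pick:
  assumes holf: "f holomorphic_on ball 0 1" and no: "\<And>z. cmod z < 1 \<Longrightarrow> cmod (f z) < 1"
    and a: "cmod a < 1" and b: "cmod b < 1"
  shows "(cmod (1 - cnj (f b) * f a))\<^sup>2 * ((1 - (cmod a)\<^sup>2) * (1 - (cmod b)\<^sup>2))
      \<le> (cmod (1 - cnj b * a))\<^sup>2 * ((1 - (cmod (f a))\<^sup>2) * (1 - (cmod (f b))\<^sup>2))"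
proof -
  define g where "g = Moebius_function 0 (f b) \<circ> (f \<circ> Moebius_function 0 (-b))"
  have b': "cmod (-b) < 1" using b by simp
  have "f \<circ> Moebius_function 0 (-b) holomorphic_on ball 0 1"
    by (rule holomorphic_on_compose_gen [OF Moebius_function_holomorphic [OF b'] holf])
      (use Moebius_function_norm_lt_1 [OF b'] in auto)
  then have hg: "g holomorphic_on ball 0 1"
    unfolding g_def
    by (rule holomorphic_on_compose_gen [OF _ Moebius_function_holomorphic [OF no [OF b]]])
      (use Moebius_function_norm_lt_1 [OF b'] no in auto)
  have ng: "cmod (g z) < 1" if "cmod z < 1" for z
    using Moebius_function_norm_lt_1 [OF b'] no b that
    by (auto simp: g_def intro!: Moebius_function_norm_lt_1)
  have g0: "g 0 = 0"
    by (simp add: g_def Moebius_function_of_zero Moebius_function_eq_zero)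
  have "cmod (g (Moebius_function 0 b a)) \<le> cmod (Moebius_function 0 b a)"
    by (rule Schwarz_Lemma(1) [OF hg g0 ng]) (use Moebius_function_norm_lt_1 [OF b a] in auto)
  also have "g (Moebius_function 0 b a) = Moebius_function 0 (f b) (f a)"
    using Moebius_function_compose [of "-b" b a] a b by (simp add: g_def)
  finally have le: "cmod (f a - f b) / cmod (1 - cnj (f b) * f a) \<le> cmod (a - b) / cmod (1 - cnj b * a)"
    by (simp add: Moebius_function_simple norm_divide)
  have nz: "1 - cnj v * u \<noteq> 0" if "cmod u < 1" "cmod v < 1" for u v
    by (metis complex_mod_cnj less_irrefl norm_mult_less norm_one mult_1 that eq_iff_diff_eq_0)
  have "cmod (f a - f b) * cmod (1 - cnj b * a) \<le> cmod (a - b) * cmod (1 - cnj (f b) * f a)"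
    using le nz [OF a b] nz [OF no [OF a] no [OF b]] by (simp add: field_simps)
  then have "(cmod (f a - f b) * cmod (1 - cnj b * a))\<^sup>2 \<le> (cmod (a - b) * cmod (1 - cnj (f b) * f a))\<^sup>2"
    by (rule power_mono) simp
  then show ?thesis
    unfolding norm_diff_sq_identity [symmetric] by (simp add: algebra_simps power_mult_distrib)
qed

text \<open>The Cayley transform \<open>(P - 1) / (P + 1)\<close> sends the right half-plane to the
  disc. Multiplying by the squared moduli of \<open>P a + 1\<close> and \<open>P b + 1\<close>
  removes it again, through \<open>sq\<close> and \<open>id2\<close>.\<close>

corollary halfplane_Schwarz_Pick:
  assumes hol: "P holomorphic_on ball 0 1" and pos: "\<And>z. cmod z < 1 \<Longrightarrow> 0 < Re (P z)"
    and a: "cmod a < 1" and b: "cmod b < 1"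
  shows "(cmod (P a + cnj (P b)))\<^sup>2 * ((1 - (cmod a)\<^sup>2) * (1 - (cmod b)\<^sup>2))
      \<le> 4 * (cmod (1 - cnj b * a))\<^sup>2 * (Re (P a) * Re (P b))"
proof -
  define f where "f z = (P z - 1) / (P z + 1)" for z
  have nz: "P z + 1 \<noteq> 0" if "cmod z < 1" for z
  proof
    assume "P z + 1 = 0"
    then have "Re (P z + 1) = 0" by simp
    then show False using pos [OF that] by simp
  qed
  have hf: "f holomorphic_on ball 0 1"
    unfolding f_def using nz by (intro holomorphic_intros hol) auto
  have sq: "(1 - (cmod (f z))\<^sup>2) * (cmod (P z + 1))\<^sup>2 = 4 * Re (P z)" if "cmod z < 1" for z
  proof -
    have "(cmod (f z))\<^sup>2 * (cmod (P z + 1))\<^sup>2 = (cmod (P z - 1))\<^sup>2"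
      using nz [OF that] by (simp add: f_def norm_divide power_divide)
    then show ?thesis
      unfolding left_diff_distrib cmod_power2 by (simp add: power2_eq_square algebra_simps)
  qed
  have no: "cmod (f z) < 1" if "cmod z < 1" for z
  proof -
    have "(1 - (cmod (f z))\<^sup>2) * (cmod (P z + 1))\<^sup>2 > 0"
      using sq [OF that] pos [OF that] by simp
    then have "(cmod (f z))\<^sup>2 < 1"
      by (simp add: zero_less_mult_iff)
    then show ?thesis by (simp add: power2_less_1_iff abs_square_less_1)
  qed
  have id: "(1 - cnj (f b) * f a) * (cnj (P b + 1) * (P a + 1)) = 2 * (P a + cnj (P b))"
  proof -
    have "f a * (P a + 1) = P a - 1" "cnj (f b * (P b + 1)) = cnj (P b - 1)"
      using nz [OF a] nz [OF b] by (auto simp: f_def)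
    then have "cnj (f b) * cnj (P b + 1) * (f a * (P a + 1)) = cnj (P b - 1) * (P a - 1)"
      by simp
    then show ?thesis by (simp add: algebra_simps)
  qed
  have id2: "(cmod (1 - cnj (f b) * f a))\<^sup>2 * ((cmod (P b + 1))\<^sup>2 * (cmod (P a + 1))\<^sup>2) = 4 * (cmod (P a + cnj (P b)))\<^sup>2"
  proof -
    have "cmod (1 - cnj (f b) * f a) * (cmod (P b + 1) * cmod (P a + 1)) = 2 * cmod (P a + cnj (P b))"
      using arg_cong [OF id, of cmod] unfolding norm_mult complex_mod_cnj by simp
    from arg_cong [OF this, of "\<lambda>x. x\<^sup>2"] show ?thesis
      by (simp add: power_mult_distrib)
  qed
  have "(cmod (1 - cnj (f b) * f a))\<^sup>2 * ((1 - (cmod a)\<^sup>2) * (1 - (cmod b)\<^sup>2)) * ((cmod (P b + 1))\<^sup>2 * (cmod (P a + 1))\<^sup>2)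
      \<le> (cmod (1 - cnj b * a))\<^sup>2 * ((1 - (cmod (f a))\<^sup>2) * (1 - (cmod (f b))\<^sup>2)) * ((cmod (P b + 1))\<^sup>2 * (cmod (P a + 1))\<^sup>2)"
    by (intro mult_right_mono Schwarz_Pick hf no a b) auto
  then have "((cmod (1 - cnj (f b) * f a))\<^sup>2 * ((cmod (P b + 1))\<^sup>2 * (cmod (P a + 1))\<^sup>2)) * ((1 - (cmod a)\<^sup>2) * (1 - (cmod b)\<^sup>2))
      \<le> (cmod (1 - cnj b * a))\<^sup>2 * (((1 - (cmod (f a))\<^sup>2) * (cmod (P a + 1))\<^sup>2) * ((1 - (cmod (f b))\<^sup>2) * (cmod (P b + 1))\<^sup>2))"
    by (simp only: mult_ac)
  then show ?thesis
    unfolding id2 sq [OF a] sq [OF b] by (simp add: mult_ac)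
qed

section \<open>Holomorphic vector fields and Euler polygons\<close>

lemma bounded_linear_scale_vec: "bounded_linear (\<lambda>c. c *s (w :: complex ^ 'n::finite))"
  by (rule bounded_linear_intro [where K = "norm w"])
    (auto simp: norm_scale_vec vec_eq_iff algebra_simps)

lemma holomorphic_vec_has_derivative:
  assumes "holomorphic_vec_on G S" "z \<in> S"
  shows "(G has_derivative dG G z) (at z)" and "dG G z (c *s w) = c *s dG G z w"
proof -
  obtain L where L: "(G has_derivative L) (at z)" and lin: "\<And>c w. L (c *s w) = c *s L w"
    using assms by (auto simp: holomorphic_vec_on_def)
  have "dG G z = L"
    unfolding dG_def using frechet_derivative_at [OF L] by auto
  then show "(G has_derivative dG G z) (at z)" "dG G z (c *s w) = c *s dG G z w"
    using L lin by auto
qed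

text \<open>A derivative of the form \<open>\<lambda>h. h *s D\<close> expresses that a curve is
  complex differentiable with velocity \<open>D\<close>; complex linearity of \<open>dG\<close>
  preserves this form.\<close>

lemma holomorphic_curve_compose:
  assumes "holomorphic_vec_on G S" "\<gamma> \<zeta> \<in> S" "(\<gamma> has_derivative (\<lambda>h. h *s D)) (at \<zeta>)"
  shows "((\<lambda>\<zeta>. G (\<gamma> \<zeta>)) has_derivative (\<lambda>h. h *s dG G (\<gamma> \<zeta>) D)) (at \<zeta>)"
  using diff_chain_at [OF assms(3) holomorphic_vec_has_derivative(1) [OF assms(1,2)]]
  by (simp add: o_def holomorphic_vec_has_derivative(2) [OF assms(1,2)])

lemma holomorphic_curve_cinner:
  assumes "(\<gamma> has_derivative (\<lambda>h. h *s D)) (at \<zeta>)"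
  shows "((\<lambda>\<zeta>. cinner (\<gamma> \<zeta>) w) has_field_derivative cinner D w) (at \<zeta>)"
  using bounded_linear.has_derivative [OF bounded_linear_cinner assms]
  by (simp add: has_field_derivative_def cinner_scale_left mult_commute_abs)

lemma affine_curve_has_derivative:
  "((\<lambda>\<zeta>. z + \<zeta> *s w) has_derivative (\<lambda>h. h *s w)) (at (\<zeta> :: complex))"
  using has_derivative_add [OF has_derivative_const bounded_linear_imp_has_derivative [OF bounded_linear_scale_vec]]
  by simp

lemma slice_has_field_derivative:
  assumes "holomorphic_vec_on G S" "z + \<zeta> *s w \<in> S"
  shows "((\<lambda>\<zeta>. G (z + \<zeta> *s w) $ j) has_field_derivative dG G (z + \<zeta> *s w) w $ j) (at \<zeta>)"
  using holomorphic_curve_cinner [OF holomorphic_curve_compose [where \<gamma> = "\<lambda>\<zeta>. z + \<zeta> *s w", OF assms affine_curve_has_derivative], where w = "cbasis j"]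
  by simp

text \<open>An affine function is subtracted before the Cauchy inequality is used. With
  \<open>c\<^sub>1 = 0\<close> the result bounds the derivative; with \<open>c\<^sub>1\<close> a
  proposed limit it measures the distance to that limit. The length of \<open>w\<close> is free and
  is absorbed by the radius.\<close>

lemma directional_Cauchy_estimate:
  assumes hol: "holomorphic_vec_on G S" and r: "0 < r"
    and disc: "\<And>\<zeta>. cmod \<zeta> \<le> r \<Longrightarrow> z + \<zeta> *s w \<in> S"
    and bd: "\<And>\<zeta>. cmod \<zeta> = r \<Longrightarrow> cmod (G (z + \<zeta> *s w) $ j - (c\<^sub>0 + c\<^sub>1 * \<zeta>)) \<le> B"
  shows "cmod (dG G z w $ j - c\<^sub>1) \<le> B / r"
proof -
  define f where "f \<zeta> = G (z + \<zeta> *s w) $ j - (c\<^sub>0 + c\<^sub>1 * \<zeta>)" for \<zeta>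
  have der: "(f has_field_derivative (dG G (z + \<zeta> *s w) w $ j - c\<^sub>1)) (at \<zeta>)" if "cmod \<zeta> \<le> r" for \<zeta>
  proof -
    have "((\<lambda>\<zeta>. c\<^sub>0 + c\<^sub>1 * \<zeta>) has_field_derivative c\<^sub>1) (at \<zeta>)"
      by (auto intro!: derivative_eq_intros)
    from DERIV_diff [OF slice_has_field_derivative [OF hol disc [OF that]] this] show ?thesis
      unfolding f_def .
  qed
  have "f holomorphic_on ball 0 r"
    unfolding holomorphic_on_def
    using der field_differentiable_at_within field_differentiable_def by (metis less_imp_le mem_ball_0)
  moreover have "continuous_on (cball 0 r) f"
    using der by (intro continuous_at_imp_continuous_on ballI) (metis DERIV_isCont mem_cball_0)
  ultimately have "cmod ((deriv ^^ 1) f 0) \<le> fact 1 * B / r ^ 1"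
    using r bd by (intro Cauchy_inequality) (auto simp: f_def)
  moreover have "deriv f 0 = dG G z w $ j - c\<^sub>1"
    using DERIV_imp_deriv [OF der [of 0]] r by simp
  ultimately show ?thesis by simp
qed

lemma holomorphic_vec_continuous_on:
  fixes G :: "complex ^ 'n::finite \<Rightarrow> complex ^ 'n"
  assumes "holomorphic_vec_on G S" "A \<subseteq> S"
  shows "continuous_on A G"
proof (rule continuous_at_imp_continuous_on, rule ballI)
  fix z assume "z \<in> A"
  then show "isCont G z"
    using has_derivative_continuous [OF holomorphic_vec_has_derivative(1) [OF assms(1)]] assms(2) by blast
qed

lemma norm_le_sum_components: "norm (x :: complex ^ 'n::finite) \<le> (\<Sum>j\<in>UNIV. cmod (x $ j))"
  unfolding norm_vec_def by (rule L2_set_le_sum) auto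

lemma holomorphic_vec_bounded_cball:
  fixes G :: "complex ^ 'n::finite \<Rightarrow> complex ^ 'n"
  assumes "holomorphic_vec_on G (ball 0 1)" "s < 1"
  obtains M where "0 \<le> M" "\<And>x. x \<in> cball 0 s \<Longrightarrow> norm (G x) \<le> M"
proof -
  have "compact (G ` cball 0 s)"
    by (intro compact_continuous_image holomorphic_vec_continuous_on [OF assms(1)]) (use assms(2) in auto)
  then obtain M where "\<And>x. x \<in> cball 0 s \<Longrightarrow> norm (G x) \<le> M"
    by (meson bounded_iff compact_imp_bounded image_eqI)
  then show ?thesis
    by (intro that [of "max M 0"]) (auto intro: max.coboundedI1)
qed

text \<open>Cauchy estimates on discs reaching into a slightly larger ball bound the derivative, and
  the mean value inequality on the convex ball does the rest. The factor \<open>CARD('n)\<close>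
  comes from estimating the components separately.\<close>

lemma holomorphic_vec_Lipschitz_cball:
  fixes G :: "complex ^ 'n::finite \<Rightarrow> complex ^ 'n"
  assumes hol: "holomorphic_vec_on G (ball 0 1)" and "s < 1"
  obtains L where "0 \<le> L" "\<And>x y. x \<in> cball 0 s \<Longrightarrow> y \<in> cball 0 s \<Longrightarrow> norm (G x - G y) \<le> L * norm (x - y)"
proof -
  define s' where "s' = (1 + s) / 2"
  have s': "s' < 1" "0 < s' - s" using assms by (auto simp: s'_def)
  obtain M where M0: "0 \<le> M" and M: "\<And>x. x \<in> cball 0 s' \<Longrightarrow> norm (G x) \<le> M"
    using holomorphic_vec_bounded_cball [OF hol s'(1)] by blast
  define L where "L = real CARD('n) * (M / (s' - s))"
  have dbd: "norm (dG G z w) \<le> L * norm w" if z: "z \<in> cball 0 s" for z w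
  proof (cases "w = 0")
    case True
    then show ?thesis
      using holomorphic_vec_has_derivative(2) [OF hol, of z 0 0] z assms(2) by auto
  next
    case False
    define r where "r = (s' - s) / norm w"
    have r: "0 < r" using False s' by (simp add: r_def)
    have in': "z + \<zeta> *s w \<in> cball 0 s'" if "cmod \<zeta> \<le> r" for \<zeta>
    proof -
      have "norm (\<zeta> *s w) \<le> s' - s"
        using that False by (simp add: r_def norm_scale_vec field_simps)
      then show ?thesis using z norm_triangle_ineq [of z "\<zeta> *s w"] by auto
    qed
    have comp: "cmod (dG G z w $ j - 0) \<le> M / r" for j
    proof (rule directional_Cauchy_estimate [OF hol r, where c\<^sub>0 = 0])
      show "z + \<zeta> *s w \<in> ball 0 1" if "cmod \<zeta> \<le> r" for \<zeta>
        using in' [OF that] s' by auto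
      show "cmod (G (z + \<zeta> *s w) $ j - (0 + 0 * \<zeta>)) \<le> M" if "cmod \<zeta> = r" for \<zeta>
        using M [OF in'] that Finite_Cartesian_Product.norm_nth_le [of "G (z + \<zeta> *s w)" j] by (simp add: order_trans)
    qed
    have "norm (dG G z w) \<le> (\<Sum>j\<in>UNIV. cmod (dG G z w $ j))"
      by (rule norm_le_sum_components)
    also have "\<dots> \<le> (\<Sum>j\<in>(UNIV::'n set). M / r)"
      using comp by (intro sum_mono) simp
    also have "\<dots> = L * norm w" by (simp add: L_def r_def)
    finally show ?thesis .
  qed
  show ?thesis
  proof
    show "0 \<le> L" using M0 s' by (simp add: L_def)
    show "norm (G x - G y) \<le> L * norm (x - y)" if "x \<in> cball 0 s" "y \<in> cball 0 s" for x y
    proof (rule differentiable_bound [of "cball 0 s" G "dG G"])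
      fix z :: "complex ^ 'n" assume z: "z \<in> cball 0 s"
      then have "z \<in> ball 0 1" using assms(2) by auto
      then show "(G has_derivative dG G z) (at z within cball 0 s)"
        by (rule has_derivative_at_withinI [OF holomorphic_vec_has_derivative(1) [OF hol]])
      show "onorm (dG G z) \<le> L"
        by (rule onorm_le) (rule dbd [OF z])
    qed (use that in simp_all)
  qed
qed

section \<open>Stability and convergence of Euler polygons\<close>

definition euler_step :: "(complex ^ 'n::finite \<Rightarrow> complex ^ 'n) \<Rightarrow> real \<Rightarrow> complex ^ 'n \<Rightarrow> complex ^ 'n" where
  "euler_step G h y = y + h *\<^sub>R G y"

definition trajectory :: "(complex ^ 'n::finite \<Rightarrow> complex ^ 'n) \<Rightarrow> (real \<Rightarrow> complex ^ 'n) \<Rightarrow> bool" where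
  "trajectory G x \<longleftrightarrow> (\<forall>t\<ge>0. x t \<in> ball 0 1 \<and> (x has_vector_derivative G (x t)) (at t within {0..}))"

text \<open>A local error of order \<open>h\<^sup>2\<close> per step is amplified by at most
  \<open>exp (L * T)\<close>. The Lipschitz constant is valid only on \<open>cball 0 s'\<close>, so
  the error bound and the containment in that ball are proved together. Uniformity near
  \<open>x 0\<close> prepares a compactness argument over starting points.\<close>

lemma euler_near_trajectory:
  fixes x :: "real \<Rightarrow> complex ^ 'n::finite"
  assumes hol: "holomorphic_vec_on G (ball 0 1)" and T: "0 < T"
    and traj: "trajectory G x"
  shows "\<exists>\<eta> C N\<^sub>0. 0 < \<eta> \<and> (\<forall>z N. norm (z - x 0) < \<eta> \<longrightarrow> N\<^sub>0 \<le> N \<longrightarrow>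
     (\<forall>k\<le>N. (euler_step G (T / real N) ^^ k) z \<in> ball 0 1) \<and>
     norm ((euler_step G (T / real N) ^^ N) z - x T) \<le> C * (norm (z - x 0) + 1 / real N))"
proof -
  have xin: "\<And>t. 0 \<le> t \<Longrightarrow> x t \<in> ball 0 1"
    and xder: "\<And>t. 0 \<le> t \<Longrightarrow> (x has_vector_derivative G (x t)) (at t within {0..})"
    using traj by (auto simp: trajectory_def)
  have contx: "continuous_on {0..T} x"
    by (rule continuous_on_vector_derivative [where f' = "\<lambda>t. G (x t)"])
      (auto intro: has_vector_derivative_within_subset [OF xder])
  obtain t\<^sub>0 where t0: "t\<^sub>0 \<in> {0..T}" and max: "\<And>t. t \<in> {0..T} \<Longrightarrow> norm (x t) \<le> norm (x t\<^sub>0)"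
    using continuous_attains_sup [OF compact_Icc _ continuous_on_norm [OF contx]] T by force
  define s where "s = norm (x t\<^sub>0)"
  have s: "s < 1" using xin [of t\<^sub>0] t0 by (simp add: s_def)
  define s' where "s' = (1 + s) / 2"
  define \<delta> where "\<delta> = s' - s"
  have s': "s' < 1" "0 < \<delta>" "s < s'" using s by (auto simp: s'_def \<delta>_def)
  have xs: "x t \<in> cball 0 s'" if "t \<in> {0..T}" for t
    using max [OF that] s' by (simp add: s_def)
  obtain M where M0: "0 \<le> M" and M: "\<And>x. x \<in> cball 0 s' \<Longrightarrow> norm (G x) \<le> M"
    using holomorphic_vec_bounded_cball [OF hol s'(1)] by blast
  obtain L where L0: "0 \<le> L" and L: "\<And>x y. x \<in> cball 0 s' \<Longrightarrow> y \<in> cball 0 s' \<Longrightarrow> norm (G x - G y) \<le> L * norm (x - y)"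
    using holomorphic_vec_Lipschitz_cball [OF hol s'(1)] by blast
  \<comment> \<open>Within a step the trajectory moves by at most \<open>3 * M * h\<close>
    (\<open>speed\<close>): \<open>M\<close> from the linear term, \<open>2 * M\<close> from the
    linearization error. The Lipschitz constant and one more factor \<open>h\<close> give
    \<open>K * h\<^sup>2\<close>.\<close>
  define K where "K = 3 * L * M"
  have K0: "0 \<le> K" using L0 M0 by (simp add: K_def)
  have speed: "norm (x u - x t) \<le> 3 * M * (u - t)" if "0 \<le> t" "t \<le> u" "u \<le> T" for t u
  proof -
    have "norm (x u - x t - (u - t) *\<^sub>R G (x t)) \<le> norm (u - t) * (2 * M)"
    proof (rule vector_differentiable_bound_linearization [where S = "{t..u}" and f' = "\<lambda>t. G (x t)"])
      show "(x has_vector_derivative G (x v)) (at v within {t..u})" if "v \<in> {t..u}" for v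
        using that \<open>0 \<le> t\<close> by (intro has_vector_derivative_within_subset [OF xder]) auto
      show "norm (G (x v) - G (x t)) \<le> 2 * M" if "v \<in> {t..u}" for v
        using norm_triangle_ineq4 [of "G (x v)" "G (x t)"] M [OF xs [of v]] M [OF xs [of t]] that \<open>0 \<le> t\<close> \<open>u \<le> T\<close>
        by auto
    qed (use that in \<open>auto simp: closed_segment_eq_real_ivl\<close>)
    moreover have "norm ((u - t) *\<^sub>R G (x t)) \<le> (u - t) * M"
      using M [OF xs [of t]] that by (simp add: mult_left_mono)
    ultimately show ?thesis
      using norm_triangle_ineq [of "x u - x t - (u - t) *\<^sub>R G (x t)" "(u - t) *\<^sub>R G (x t)"] that
      by (simp add: algebra_simps)
  qed
  have local_err: "norm (x (t + h) - x t - h *\<^sub>R G (x t)) \<le> K * h\<^sup>2" if "0 \<le> t" "0 \<le> h" "t + h \<le> T" for t h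
  proof -
    have "norm (x (t + h) - x t - (t + h - t) *\<^sub>R G (x t)) \<le> norm (t + h - t) * (L * (3 * M * h))"
    proof (rule vector_differentiable_bound_linearization [where S = "{t..t+h}" and f' = "\<lambda>t. G (x t)"])
      show "(x has_vector_derivative G (x v)) (at v within {t..t+h})" if "v \<in> {t..t+h}" for v
        using that \<open>0 \<le> t\<close> by (intro has_vector_derivative_within_subset [OF xder]) auto
      show "norm (G (x v) - G (x t)) \<le> L * (3 * M * h)" if v: "v \<in> {t..t+h}" for v
      proof -
        have "norm (G (x v) - G (x t)) \<le> L * norm (x v - x t)"
          using v \<open>0 \<le> t\<close> \<open>t + h \<le> T\<close> by (intro L xs) auto
        also have "\<dots> \<le> L * (3 * M * (v - t))"
          using v \<open>0 \<le> t\<close> \<open>t + h \<le> T\<close> L0 by (intro mult_left_mono speed) auto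
        also have "\<dots> \<le> L * (3 * M * h)"
          using v L0 M0 by (intro mult_left_mono) auto
        finally show ?thesis .
      qed
    qed (use that in \<open>auto simp: closed_segment_eq_real_ivl\<close>)
    then show ?thesis using that by (simp add: K_def power2_eq_square algebra_simps)
  qed
  define E where "E = exp (L * T)"
  have E0: "0 < E" by (simp add: E_def)
  \<comment> \<open>The margin \<open>\<delta>\<close> is halved: \<open>\<eta>\<close> limits the
    amplified initial error, \<open>N\<^sub>0\<close> the accumulated discretization error. The
    \<open>+ 1\<close> keeps \<open>N\<close> positive, so that \<open>T / real N\<close> is a
    genuine step.\<close>
  define \<eta> where "\<eta> = \<delta> / (2 * E)"
  define N\<^sub>0 where "N\<^sub>0 = nat \<lceil>2 * E * T\<^sup>2 * K / \<delta>\<rceil> + 1"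
  have N0: "E * (T\<^sup>2 * K / N) \<le> \<delta> / 2" if "N\<^sub>0 \<le> N" for N :: nat
  proof -
    have "2 * E * T\<^sup>2 * K / \<delta> \<le> real N"
      using that unfolding N\<^sub>0_def by linarith
    moreover have "0 < real N" using that by (simp add: N\<^sub>0_def)
    ultimately show ?thesis using s'(2) by (simp add: field_simps)
  qed
  have main: "norm ((euler_step G (T / real N) ^^ k) z - x (k * (T / real N))) \<le> E * (norm (z - x 0) + T\<^sup>2 * K / N)
      \<and> (euler_step G (T / real N) ^^ k) z \<in> cball 0 s'"
    if z: "norm (z - x 0) < \<eta>" and N: "N\<^sub>0 \<le> N" and "k \<le> N" for z N k
  proof -
    define h where "h = T / real N"
    have Npos: "0 < real N" using N by (simp add: N\<^sub>0_def)
    have h0: "0 < h" using T Npos by (simp add: h_def)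
    have kT: "real k * h \<le> T" if "k \<le> N" for k
      using that T Npos by (simp add: h_def field_simps)
    define y where "y k = (euler_step G h ^^ k) z" for k
    define e where "e k = norm (y k - x (k * h))" for k
    have grow: "(1 + h * L) ^ k * (norm (z - x 0) + k * (K * h\<^sup>2)) \<le> E * (norm (z - x 0) + T\<^sup>2 * K / N)"
      if "k \<le> N" for k
    proof (rule mult_mono)
      have "(1 + h * L) ^ k \<le> exp (h * L) ^ k"
        using h0 L0 by (intro power_mono) (auto simp: add_nonneg_nonneg)
      also have "\<dots> = exp (k * h * L)" by (simp add: exp_of_nat_mult [symmetric] mult_ac)
      also have "\<dots> \<le> E" unfolding E_def using kT [OF that] L0 by (simp add: mult.commute mult_left_mono)
      finally show "(1 + h * L) ^ k \<le> E" .
      have "real k * (K * h\<^sup>2) \<le> real N * (K * h\<^sup>2)"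
        using that K0 by (intro mult_right_mono) auto
      also have "\<dots> = T\<^sup>2 * K / N" using Npos by (simp add: h_def power2_eq_square)
      finally show "norm (z - x 0) + k * (K * h\<^sup>2) \<le> norm (z - x 0) + T\<^sup>2 * K / N" by simp
    qed (use E0 K0 in auto)
    have small: "E * (norm (z - x 0) + T\<^sup>2 * K / N) \<le> \<delta>"
    proof -
      have "E * norm (z - x 0) \<le> E * \<eta>" using z E0 by (intro mult_left_mono) auto
      also have "\<dots> = \<delta> / 2" using E0 by (simp add: \<eta>_def)
      finally show ?thesis using N0 [OF N] unfolding distrib_left by linarith
    qed
    have near: "y k \<in> cball 0 s'" if "k \<le> N" "e k \<le> \<delta>" for k
    proof -
      have "norm (x (k * h)) \<le> s"
        using max [of "k * h"] kT [OF that(1)] h0 by (simp add: s_def)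
      then show ?thesis
        using that(2) norm_triangle_ineq [of "y k - x (k * h)" "x (k * h)"] by (simp add: e_def \<delta>_def)
    qed
    have ind: "e k \<le> (1 + h * L) ^ k * (norm (z - x 0) + k * (K * h\<^sup>2))" if "k \<le> N" for k
      using that
    proof (induction k)
      case 0
      then show ?case by (simp add: e_def y_def)
    next
      case (Suc k)
      then have IH: "e k \<le> (1 + h * L) ^ k * (norm (z - x 0) + k * (K * h\<^sup>2))" by simp
      \<comment> \<open>The error so far is at most \<open>\<delta>\<close>, so the iterate still
        lies in the ball where \<open>L\<close> is valid and one more step can be estimated.\<close>
      have ek: "e k \<le> \<delta>" using IH grow [of k] small Suc.prems by linarith
      have yk: "y k \<in> cball 0 s'" using near [OF _ ek] Suc.prems by simp
      have xk: "x (k * h) \<in> cball 0 s'" using kT [of k] Suc.prems h0 by (intro xs) auto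
      have tS: "real (Suc k) * h = k * h + h" by (simp add: algebra_simps)
      have "y (Suc k) - x (Suc k * h) = (y k - x (k * h)) + h *\<^sub>R (G (y k) - G (x (k * h)))
          - (x (k * h + h) - x (k * h) - h *\<^sub>R G (x (k * h)))"
        unfolding tS by (simp add: y_def euler_step_def algebra_simps)
      then have "e (Suc k) = norm ((y k - x (k * h)) + h *\<^sub>R (G (y k) - G (x (k * h)))
          - (x (k * h + h) - x (k * h) - h *\<^sub>R G (x (k * h))))"
        by (simp only: e_def)
      also have "\<dots> \<le> e k + norm (h *\<^sub>R (G (y k) - G (x (k * h))))
          + norm (x (k * h + h) - x (k * h) - h *\<^sub>R G (x (k * h)))"
        unfolding e_def by (rule order_trans [OF norm_triangle_ineq4 add_right_mono [OF norm_triangle_ineq]])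
      also have "norm (h *\<^sub>R (G (y k) - G (x (k * h)))) \<le> h * (L * e k)"
        using L [OF yk xk] h0 by (simp add: e_def mult_left_mono)
      also have "norm (x (k * h + h) - x (k * h) - h *\<^sub>R G (x (k * h))) \<le> K * h\<^sup>2"
        using kT [OF Suc.prems] h0 tS by (intro local_err) auto
      finally have "e (Suc k) \<le> (1 + h * L) * e k + K * h\<^sup>2" by (simp add: algebra_simps)
      also have "\<dots> \<le> (1 + h * L) * ((1 + h * L) ^ k * (norm (z - x 0) + k * (K * h\<^sup>2))) + K * h\<^sup>2"
        using IH h0 L0 by (intro add_right_mono mult_left_mono) (auto simp: add_nonneg_nonneg)
      also have "\<dots> \<le> (1 + h * L) * ((1 + h * L) ^ k * (norm (z - x 0) + k * (K * h\<^sup>2))) + (1 + h * L) ^ Suc k * (K * h\<^sup>2)"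
      proof -
        have "1 \<le> (1 + h * L) ^ Suc k" using h0 L0 by (intro one_le_power) auto
        then have "1 * (K * h\<^sup>2) \<le> (1 + h * L) ^ Suc k * (K * h\<^sup>2)"
          using K0 by (intro mult_right_mono) auto
        then show ?thesis by simp
      qed
      also have "\<dots> = (1 + h * L) ^ Suc k * (norm (z - x 0) + Suc k * (K * h\<^sup>2))"
        by (simp add: algebra_simps)
      finally show ?case .
    qed
    have "e k \<le> E * (norm (z - x 0) + T\<^sup>2 * K / N)"
      using ind [OF \<open>k \<le> N\<close>] grow [OF \<open>k \<le> N\<close>] by linarith
    moreover from this have "y k \<in> cball 0 s'"
      using small \<open>k \<le> N\<close> by (intro near) auto
    ultimately show ?thesis by (simp add: e_def y_def h_def)
  qed
  show ?thesis
  proof (intro exI conjI allI impI)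
    show "0 < \<eta>" using s' E0 by (simp add: \<eta>_def)
    show "(euler_step G (T / real N) ^^ k) z \<in> ball 0 1" if "norm (z - x 0) < \<eta>" "N\<^sub>0 \<le> N" "k \<le> N" for z N k
      using main [OF that] s'(1) by auto
    show "norm ((euler_step G (T / real N) ^^ N) z - x T) \<le> E * (1 + T\<^sup>2 * K) * (norm (z - x 0) + 1 / N)"
      if "norm (z - x 0) < \<eta>" "N\<^sub>0 \<le> N" for z N
    proof -
      have Npos: "0 < real N" using that by (simp add: N\<^sub>0_def)
      have "norm ((euler_step G (T / real N) ^^ N) z - x T) \<le> E * (norm (z - x 0) + T\<^sup>2 * K / N)"
        using main [OF that order_refl] Npos by simp
      also have "\<dots> \<le> E * ((1 + T\<^sup>2 * K) * (norm (z - x 0) + 1 / N))"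
      proof (rule mult_left_mono)
        have "0 \<le> T\<^sup>2 * K * norm (z - x 0)" "0 \<le> 1 / real N" using K0 by auto
        then show "norm (z - x 0) + T\<^sup>2 * K / real N \<le> (1 + T\<^sup>2 * K) * (norm (z - x 0) + 1 / real N)"
          unfolding distrib_left distrib_right by simp
      qed (use E0 in simp)
      finally show ?thesis by (simp add: mult.assoc)
    qed
  qed
qed

lemma euler_converges:
  fixes x :: "real \<Rightarrow> complex ^ 'n::finite"
  assumes "holomorphic_vec_on G (ball 0 1)" "0 < T" "trajectory G x"
  shows "(\<lambda>N. (euler_step G (T / real N) ^^ N) (x 0)) \<longlonglongrightarrow> x T"
proof -
  obtain \<eta> C N\<^sub>0 where "0 < \<eta>" and
    *: "\<forall>z N. norm (z - x 0) < \<eta> \<longrightarrow> N\<^sub>0 \<le> N \<longrightarrow> (\<forall>k\<le>N. (euler_step G (T / real N) ^^ k) z \<in> ball 0 1) \<and>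
       norm ((euler_step G (T / real N) ^^ N) z - x T) \<le> C * (norm (z - x 0) + 1 / real N)"
    using euler_near_trajectory [OF assms] by (elim exE conjE) (rule that)
  have "(\<lambda>N. (euler_step G (T / real N) ^^ N) (x 0) - x T) \<longlonglongrightarrow> 0"
  proof (rule Lim_null_comparison)
    show "\<forall>\<^sub>F N in sequentially. norm ((euler_step G (T / real N) ^^ N) (x 0) - x T) \<le> C * (1 / real N)"
      using spec [OF *, of "x 0"] \<open>0 < \<eta>\<close> by (auto simp: eventually_sequentially)
    show "(\<lambda>N. C * (1 / real N)) \<longlonglongrightarrow> 0"
      using tendsto_mult_right_zero [OF lim_1_over_n] by simp
  qed
  then show ?thesis by (simp add: LIM_zero_iff)
qed

lemma generator_trajectory:
  assumes "infinitesimal_generator G" "z \<in> ball 0 1"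
  obtains x where "x 0 = z" "trajectory G x"
  using assms unfolding infinitesimal_generator_def trajectory_def by meson

text \<open>The threshold depends on the starting point, and a finite subcover of \<open>K\<close>
  makes it uniform. One common \<open>N\<close> matters because an iterate has to be defined over a
  whole disc to be a holomorphic function on it.\<close>

lemma euler_stays_in_ball:
  fixes G :: "complex ^ 'n::finite \<Rightarrow> complex ^ 'n"
  assumes gen: "infinitesimal_generator G" and K: "compact K" "K \<subseteq> ball 0 1" and T: "0 < T"
  obtains N\<^sub>0 where "\<And>z N k. z \<in> K \<Longrightarrow> N\<^sub>0 \<le> N \<Longrightarrow> k \<le> N \<Longrightarrow> (euler_step G (T / real N) ^^ k) z \<in> ball 0 1"
proof -
  have "\<exists>\<eta> N\<^sub>0. 0 < \<eta> \<and> (\<forall>z N k. norm (z - z\<^sub>0) < \<eta> \<longrightarrow> N\<^sub>0 \<le> N \<longrightarrow> k \<le> N \<longrightarrow> (euler_step G (T / real N) ^^ k) z \<in> ball 0 1)"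
    if "z\<^sub>0 \<in> K" for z\<^sub>0
  proof -
    obtain x where x: "x 0 = z\<^sub>0" "trajectory G x"
      using generator_trajectory [OF gen subsetD [OF K(2) \<open>z\<^sub>0 \<in> K\<close>]] .
    have hol: "holomorphic_vec_on G (ball 0 1)" using gen by (simp add: infinitesimal_generator_def)
    show ?thesis
      using euler_near_trajectory [OF hol T x(2)] unfolding x(1) by (elim ex_forward) auto
  qed
  then obtain \<eta> n where \<eta>: "\<And>z\<^sub>0. z\<^sub>0 \<in> K \<Longrightarrow> 0 < \<eta> z\<^sub>0"
    and n: "\<And>z\<^sub>0 z N k. z\<^sub>0 \<in> K \<Longrightarrow> norm (z - z\<^sub>0) < \<eta> z\<^sub>0 \<Longrightarrow> n z\<^sub>0 \<le> N \<Longrightarrow> k \<le> N \<Longrightarrow> (euler_step G (T / real N) ^^ k) z \<in> ball 0 1"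
    by metis
  have "K \<subseteq> (\<Union>c\<in>K. ball c (\<eta> c))"
    using \<eta> by auto
  then obtain C where C: "C \<subseteq> K" "finite C" "K \<subseteq> (\<Union>c\<in>C. ball c (\<eta> c))"
    using compactE_image [OF K(1), of K "\<lambda>c. ball c (\<eta> c)"] by blast
  show ?thesis
  \<comment> \<open>The inserted \<open>0\<close> gives \<open>Max\<close> a value when the subcover
    is empty.\<close>
  proof (rule that [of "Max (insert 0 (n ` C))"])
    fix z N k assume z: "z \<in> K" and N: "Max (insert 0 (n ` C)) \<le> N" and k: "k \<le> N"
    obtain c where c: "c \<in> C" "norm (z - c) < \<eta> c"
      using C(3) z by (auto simp: dist_norm norm_minus_commute)
    have "n c \<le> N" using N c(1) C(2) by simp
    then show "(euler_step G (T / real N) ^^ k) z \<in> ball 0 1"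
      using n c C(1) k by blast
  qed
qed

section \<open>The two-point inequality\<close>

lemma one_minus_cinner_nonzero:
  assumes "norm z < 1" "norm w \<le> 1"
  shows "1 - cinner z w \<noteq> 0"
proof
  assume "1 - cinner z w = 0"
  then have "cmod (cinner z w) = 1" by simp
  moreover have "norm z * norm w < 1"
    using assms by (metis le_less_trans mult_left_le norm_ge_zero)
  ultimately show False using cinner_Cauchy_Schwarz [of z w] by linarith
qed

text \<open>An Euler step is the identity plus a multiple of \<open>G\<close>, hence holomorphic
  where \<open>G\<close> is. The condition stops at \<open>i < k\<close> because the last iterate is
  not fed into \<open>G\<close> again.\<close>

lemma euler_iterate_holomorphic_curve:
  assumes hol: "holomorphic_vec_on G (ball 0 1)" and der: "(\<gamma> has_derivative (\<lambda>h. h *s D)) (at \<zeta>)"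
    and "\<And>i. i < k \<Longrightarrow> (euler_step G h ^^ i) (\<gamma> \<zeta>) \<in> ball 0 1"
  shows "\<exists>D'. ((\<lambda>\<zeta>. (euler_step G h ^^ k) (\<gamma> \<zeta>)) has_derivative (\<lambda>h. h *s D')) (at \<zeta>)"
  using assms(3)
proof (induction k)
  case 0
  show ?case using der by auto
next
  case (Suc k)
  then obtain D' where D': "((\<lambda>\<zeta>. (euler_step G h ^^ k) (\<gamma> \<zeta>)) has_derivative (\<lambda>h. h *s D')) (at \<zeta>)"
    by auto
  have d: "((\<lambda>\<zeta>. (euler_step G h ^^ k) (\<gamma> \<zeta>) + h *\<^sub>R G ((euler_step G h ^^ k) (\<gamma> \<zeta>))) has_derivative
      (\<lambda>c. c *s D' + h *\<^sub>R (c *s dG G ((euler_step G h ^^ k) (\<gamma> \<zeta>)) D'))) (at \<zeta>)"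
    using Suc.prems [of k] by (intro has_derivative_add has_derivative_scaleR_right D' holomorphic_curve_compose [OF hol]) auto
  have eq: "(\<lambda>c. c *s D' + h *\<^sub>R (c *s dG G ((euler_step G h ^^ k) (\<gamma> \<zeta>)) D'))
      = (\<lambda>c. c *s (D' + h *\<^sub>R dG G ((euler_step G h ^^ k) (\<gamma> \<zeta>)) D'))"
    by (auto simp: vec_eq_iff algebra_simps)
  have st: "(euler_step G h ^^ Suc k) y = (euler_step G h ^^ k) y + h *\<^sub>R G ((euler_step G h ^^ k) y)" for y
    by (simp add: euler_step_def [of G h "(euler_step G h ^^ k) y"])
  show ?case
    unfolding st using d unfolding eq by (rule exI)
qed

text \<open>For \<open>z \<noteq> w\<close> the affine disc \<open>\<zeta> \<mapsto> c + \<rho> \<zeta> v\<close> passes through both points, and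
  \<open>x \<mapsto> \<rho> \<langle>x,v\<rangle> / (1 - \<langle>x,c\<rangle>)\<close> is a holomorphic left inverse of it that maps the ball to the disc.\<close>

locale geodesic_disc =
  fixes c v :: "complex ^ 'n::finite" and \<rho> :: real
  assumes v: "norm v = 1" and orth: "cinner c v = 0" and c: "norm c < 1"
    and \<rho>: "0 < \<rho>" "\<rho>\<^sup>2 = 1 - (norm c)\<^sup>2"
begin

text \<open>The left inverse is kept as numerator and denominator. Both are affine in
  \<open>x\<close>, so they are differentiated directly along a trajectory, and no quotient has to
  be.\<close>

definition num :: "complex ^ 'n \<Rightarrow> complex" where "num x = of_real \<rho> * cinner x v"
definition den :: "complex ^ 'n \<Rightarrow> complex" where "den x = 1 - cinner x c"
definition pt :: "complex \<Rightarrow> complex ^ 'n" where "pt \<zeta> = c + (of_real \<rho> * \<zeta>) *s v"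

lemma orth': "cinner v c = 0"
  using orth cinner_cnj [of c v] by simp

text \<open>Since \<open>c\<close> is orthogonal to \<open>v\<close>, \<open>cinner x v\<close>
  equals \<open>cinner (x - c) v\<close> and is bounded by \<open>norm (x - c)\<close>. Multiplied
  by \<open>\<rho>\<^sup>2 = 1 - (norm c)\<^sup>2\<close>, the resulting bound becomes
  \<open>(cmod (1 - g))\<^sup>2\<close> minus a square.\<close>

lemma num_less_den:
  assumes x: "norm x < 1"
  shows "cmod (num x) < cmod (den x)"
proof -
  define g where "g = cinner x c"
  have "cmod (cinner (x - c) v) \<le> norm (x - c)"
    using cinner_Cauchy_Schwarz [of "x - c" v] v by simp
  then have "(cmod (cinner x v))\<^sup>2 \<le> (norm (x - c))\<^sup>2"
    by (auto simp: cinner_diff_left orth intro: power_mono)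
  also have "(norm (x - c))\<^sup>2 = (norm x)\<^sup>2 - 2 * Re g + (norm c)\<^sup>2"
    by (simp add: g_def Re_cinner power2_norm_eq_inner inner_diff_left inner_diff_right inner_commute)
  also have "\<dots> < 1 - 2 * Re g + (norm c)\<^sup>2"
    using x abs_square_less_1 [of "norm x"] by simp
  finally have "(cmod (cinner x v))\<^sup>2 < 1 - 2 * Re g + (norm c)\<^sup>2" .
  then have "\<rho>\<^sup>2 * (cmod (cinner x v))\<^sup>2 < \<rho>\<^sup>2 * (1 - 2 * Re g + (norm c)\<^sup>2)"
    using \<rho>(1) by (intro mult_strict_left_mono) auto
  also have "\<dots> = (cmod (1 - g))\<^sup>2 - (cmod (g - of_real ((norm c)\<^sup>2)))\<^sup>2"
    unfolding \<rho>(2) cmod_power2 by (simp add: power2_eq_square algebra_simps)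
  also have "\<dots> \<le> (cmod (1 - g))\<^sup>2" by simp
  finally have "(cmod (num x))\<^sup>2 < (cmod (den x))\<^sup>2"
    using \<rho>(1) by (simp add: num_def den_def g_def norm_mult power_mult_distrib)
  then show ?thesis by (rule power2_less_imp_less) simp
qed

lemma cinner_pt: "1 - cinner (pt \<zeta>) (pt \<xi>) = \<rho>\<^sup>2 * (1 - \<zeta> * cnj \<xi>)"
proof -
  have "complex_of_real (\<rho>\<^sup>2) = 1 - of_real ((norm c)\<^sup>2)" using \<rho>(2) by simp
  then show ?thesis
    using v by (simp add: pt_def cinner_add_left cinner_add_right cinner_scale_left cinner_scale_right orth orth'
        cinner_self algebra_simps power2_eq_square)
qed

lemma norm_pt: "1 - (norm (pt \<zeta>))\<^sup>2 = \<rho>\<^sup>2 * (1 - (cmod \<zeta>)\<^sup>2)"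
proof -
  have "complex_of_real (1 - (norm (pt \<zeta>))\<^sup>2) = of_real (\<rho>\<^sup>2 * (1 - (cmod \<zeta>)\<^sup>2))"
    using cinner_pt [of \<zeta> \<zeta>] unfolding cinner_self complex_norm_square [symmetric] by simp
  then show ?thesis by (simp only: of_real_eq_iff)
qed

lemma pt_in_ball:
  assumes "cmod \<zeta> < 1"
  shows "norm (pt \<zeta>) < 1"
proof -
  have "0 < \<rho>\<^sup>2 * (1 - (cmod \<zeta>)\<^sup>2)" using \<rho>(1) assms by (simp add: power_less_one_iff)
  then have "(norm (pt \<zeta>))\<^sup>2 < 1" using norm_pt [of \<zeta>] by simp
  then show ?thesis by (simp add: abs_square_less_1)
qed

lemma num_pt: "num (pt \<zeta>) = of_real (\<rho>\<^sup>2) * \<zeta>"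
  using v by (simp add: num_def pt_def cinner_add_left cinner_scale_left orth cinner_self power2_eq_square)

lemma den_pt: "den (pt \<zeta>) = of_real (\<rho>\<^sup>2)"
  using \<rho>(2) by (simp add: den_def pt_def cinner_add_left cinner_scale_left orth' cinner_self)

text \<open>Schwarz--Pick is applied to the left inverse composed with an Euler iterate on the disc.
  The limit of the polygons is taken only at the two given points, where their convergence is
  known.\<close>

lemma Schwarz_Pick_flow:
  assumes gen: "infinitesimal_generator G"
    and x: "x 0 = pt \<zeta>\<^sub>1" "trajectory G x"
    and y: "y 0 = pt \<zeta>\<^sub>2" "trajectory G y"
    and \<zeta>: "cmod \<zeta>\<^sub>1 < 1" "cmod \<zeta>\<^sub>2 < 1" and T: "0 < T"
  shows "(cmod (den (x T) * cnj (den (y T)) - num (x T) * cnj (num (y T))))\<^sup>2 * ((1 - (cmod \<zeta>\<^sub>1)\<^sup>2) * (1 - (cmod \<zeta>\<^sub>2)\<^sup>2))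
    \<le> (cmod (1 - cnj \<zeta>\<^sub>2 * \<zeta>\<^sub>1))\<^sup>2 * (((cmod (den (x T)))\<^sup>2 - (cmod (num (x T)))\<^sup>2) * ((cmod (den (y T)))\<^sup>2 - (cmod (num (y T)))\<^sup>2))"
proof -
  have hol: "holomorphic_vec_on G (ball 0 1)" using gen by (simp add: infinitesimal_generator_def)
  define E where "E N = euler_step G (T / real N) ^^ N" for N
  \<comment> \<open>The right-hand side minus the left-hand side, with end points and parameters
    left free. Being continuous along both limits, in \<open>N\<close> and in \<open>s\<close>, it
    keeps its sign.\<close>
  define \<Phi> where "\<Phi> p q a b = (cmod (1 - cnj b * a))\<^sup>2 * (((cmod (den p))\<^sup>2 - (cmod (num p))\<^sup>2) * ((cmod (den q))\<^sup>2 - (cmod (num q))\<^sup>2))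
      - (cmod (den p * cnj (den q) - num p * cnj (num q)))\<^sup>2 * ((1 - (cmod a)\<^sup>2) * (1 - (cmod b)\<^sup>2))" for p q a b
  \<comment> \<open>Polygons stay in the ball uniformly only over compact sets, so the disc is
    shrunk by a factor \<open>s < 1\<close>. The two points then have parameters
    \<open>\<zeta>\<^sub>1 / s\<close> and \<open>\<zeta>\<^sub>2 / s\<close>, and \<open>s\<close>
    tends to 1 at the end.\<close>
  have step: "0 \<le> \<Phi> (x T) (y T) (\<zeta>\<^sub>1 / of_real s) (\<zeta>\<^sub>2 / of_real s)"
    if s: "cmod \<zeta>\<^sub>1 < s" "cmod \<zeta>\<^sub>2 < s" "s < 1" for s
  proof -
    have s0: "0 < s" using s(1) norm_ge_zero [of \<zeta>\<^sub>1] by linarith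
    have contpt: "continuous_on A pt" for A
      unfolding pt_def
      by (intro continuous_intros bounded_linear.continuous_on [OF bounded_linear_scale_vec])
    have "compact (pt ` cball 0 s)" "pt ` cball 0 s \<subseteq> ball 0 1"
      using s(3) by (auto intro!: compact_continuous_image contpt pt_in_ball)
    then obtain N\<^sub>0 where N0: "\<And>z N k. z \<in> pt ` cball 0 s \<Longrightarrow> N\<^sub>0 \<le> N \<Longrightarrow> k \<le> N \<Longrightarrow> (euler_step G (T / real N) ^^ k) z \<in> ball 0 1"
      using euler_stays_in_ball [OF gen _ _ T] by blast
    have pos: "0 \<le> \<Phi> (E N (x 0)) (E N (y 0)) (\<zeta>\<^sub>1 / of_real s) (\<zeta>\<^sub>2 / of_real s)" if N: "N\<^sub>0 \<le> N" for N
    proof -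
      define F where "F \<zeta> = num (E N (pt (of_real s * \<zeta>))) / den (E N (pt (of_real s * \<zeta>)))" for \<zeta>
      have inb: "(euler_step G (T / real N) ^^ k) (pt (of_real s * \<zeta>)) \<in> ball 0 1" if "cmod \<zeta> < 1" "k \<le> N" for \<zeta> k
        using that s0 by (intro N0 [OF _ N]) (auto simp: norm_mult mult_le_cancel_left1)
      have Eb: "norm (E N (pt (of_real s * \<zeta>))) < 1" if "cmod \<zeta> < 1" for \<zeta>
        using inb [OF that, of N] by (simp add: E_def)
      have dnz: "den (E N (pt (of_real s * \<zeta>))) \<noteq> 0" if "cmod \<zeta> < 1" for \<zeta>
        using num_less_den [OF Eb [OF that]] by auto
      have "F field_differentiable (at \<zeta>)" if \<zeta>: "cmod \<zeta> < 1" for \<zeta>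
      proof -
        have eq: "pt (of_real s * \<zeta>) = c + \<zeta> *s (of_real (\<rho> * s) *s v)" for \<zeta>
          by (simp add: pt_def vec_eq_iff)
        have "((\<lambda>\<zeta>. pt (of_real s * \<zeta>)) has_derivative (\<lambda>h. h *s (of_real (\<rho> * s) *s v))) (at \<zeta>)"
          unfolding eq by (rule affine_curve_has_derivative)
        then obtain D where D: "((\<lambda>\<zeta>. E N (pt (of_real s * \<zeta>))) has_derivative (\<lambda>h. h *s D)) (at \<zeta>)"
          using euler_iterate_holomorphic_curve [OF hol, where \<gamma> = "\<lambda>\<zeta>. pt (of_real s * \<zeta>)" and k = N] inb [OF \<zeta>]
          unfolding E_def by (metis less_imp_le)
        have "(\<lambda>\<zeta>. cinner (E N (pt (of_real s * \<zeta>))) u) field_differentiable (at \<zeta>)" for u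
          using holomorphic_curve_cinner [OF D] field_differentiable_def by blast
        then show ?thesis
          unfolding F_def num_def den_def using dnz [OF \<zeta>, unfolded den_def]
          by (intro field_differentiable_divide field_differentiable_mult field_differentiable_diff field_differentiable_const) auto
      qed
      then have holF: "F holomorphic_on ball 0 1"
        unfolding holomorphic_on_def using field_differentiable_at_within by (metis mem_ball_0)
      have noF: "cmod (F \<zeta>) < 1" if "cmod \<zeta> < 1" for \<zeta>
        using num_less_den [OF Eb [OF that]] dnz [OF that] by (simp add: F_def norm_divide)
      define a b where "a = \<zeta>\<^sub>1 / of_real s" and "b = \<zeta>\<^sub>2 / of_real s"
      have ab: "cmod a < 1" "cmod b < 1" using s s0 by (auto simp: a_def b_def norm_divide)
      define n\<^sub>1 d\<^sub>1 n\<^sub>2 d\<^sub>2 where "n\<^sub>1 = num (E N (x 0))" and "d\<^sub>1 = den (E N (x 0))"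
        and "n\<^sub>2 = num (E N (y 0))" and "d\<^sub>2 = den (E N (y 0))"
      have Fab: "F a = n\<^sub>1 / d\<^sub>1" "F b = n\<^sub>2 / d\<^sub>2"
        using s0 by (auto simp: F_def a_def b_def n\<^sub>1_def d\<^sub>1_def n\<^sub>2_def d\<^sub>2_def x(1) y(1))
      have d: "d\<^sub>1 \<noteq> 0" "d\<^sub>2 \<noteq> 0"
        using dnz [OF ab(1)] dnz [OF ab(2)] s0 by (auto simp: a_def b_def d\<^sub>1_def d\<^sub>2_def x(1) y(1))
      have q: "(1 - (cmod (n / d))\<^sup>2) * (cmod d)\<^sup>2 = (cmod d)\<^sup>2 - (cmod n)\<^sup>2" if "d \<noteq> 0" for n d
        using that by (simp add: norm_divide power_divide field_simps)
      have "(1 - cnj (n\<^sub>2 / d\<^sub>2) * (n\<^sub>1 / d\<^sub>1)) * (d\<^sub>1 * cnj d\<^sub>2) = d\<^sub>1 * cnj d\<^sub>2 - n\<^sub>1 * cnj n\<^sub>2"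
        using d by (simp add: field_simps)
      then have q2: "(cmod (1 - cnj (n\<^sub>2 / d\<^sub>2) * (n\<^sub>1 / d\<^sub>1)))\<^sup>2 * ((cmod d\<^sub>1)\<^sup>2 * (cmod d\<^sub>2)\<^sup>2) = (cmod (d\<^sub>1 * cnj d\<^sub>2 - n\<^sub>1 * cnj n\<^sub>2))\<^sup>2"
        by (metis complex_mod_cnj norm_mult power_mult_distrib)
      have "(cmod (1 - cnj (F b) * F a))\<^sup>2 * ((1 - (cmod a)\<^sup>2) * (1 - (cmod b)\<^sup>2)) * ((cmod d\<^sub>1)\<^sup>2 * (cmod d\<^sub>2)\<^sup>2)
        \<le> (cmod (1 - cnj b * a))\<^sup>2 * ((1 - (cmod (F a))\<^sup>2) * (1 - (cmod (F b))\<^sup>2)) * ((cmod d\<^sub>1)\<^sup>2 * (cmod d\<^sub>2)\<^sup>2)"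
        by (intro mult_right_mono Schwarz_Pick holF noF ab) auto
      then have "((cmod (1 - cnj (F b) * F a))\<^sup>2 * ((cmod d\<^sub>1)\<^sup>2 * (cmod d\<^sub>2)\<^sup>2)) * ((1 - (cmod a)\<^sup>2) * (1 - (cmod b)\<^sup>2))
        \<le> (cmod (1 - cnj b * a))\<^sup>2 * (((1 - (cmod (F a))\<^sup>2) * (cmod d\<^sub>1)\<^sup>2) * ((1 - (cmod (F b))\<^sup>2) * (cmod d\<^sub>2)\<^sup>2))"
        by (simp only: mult_ac)
      then show ?thesis
        unfolding Fab q [OF d(1)] q [OF d(2)] q2
        by (simp add: \<Phi>_def a_def b_def n\<^sub>1_def d\<^sub>1_def n\<^sub>2_def d\<^sub>2_def)
    qed
    have lims: "(\<lambda>N. E N (x 0)) \<longlonglongrightarrow> x T" "(\<lambda>N. E N (y 0)) \<longlonglongrightarrow> y T"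
      unfolding E_def using euler_converges [OF hol T x(2)] euler_converges [OF hol T y(2)] by auto
    have "(\<lambda>N. \<Phi> (E N (x 0)) (E N (y 0)) (\<zeta>\<^sub>1 / of_real s) (\<zeta>\<^sub>2 / of_real s)) \<longlonglongrightarrow> \<Phi> (x T) (y T) (\<zeta>\<^sub>1 / of_real s) (\<zeta>\<^sub>2 / of_real s)"
      unfolding \<Phi>_def num_def den_def
      by (intro tendsto_intros lims bounded_linear.tendsto [OF bounded_linear_cinner])
    then show ?thesis
      by (rule tendsto_lowerbound) (use pos in \<open>auto simp: eventually_sequentially\<close>)
  qed
  have "((\<lambda>s. \<Phi> (x T) (y T) (\<zeta>\<^sub>1 / of_real s) (\<zeta>\<^sub>2 / of_real s)) \<longlongrightarrow> \<Phi> (x T) (y T) (\<zeta>\<^sub>1 / of_real 1) (\<zeta>\<^sub>2 / of_real 1)) (at_left 1)"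
    unfolding \<Phi>_def by (intro tendsto_intros) auto
  then have "0 \<le> \<Phi> (x T) (y T) (\<zeta>\<^sub>1 / of_real 1) (\<zeta>\<^sub>2 / of_real 1)"
  proof (rule tendsto_lowerbound)
    have "\<forall>\<^sub>F s in at_left 1. s \<in> {max (cmod \<zeta>\<^sub>1) (cmod \<zeta>\<^sub>2)<..<1}"
      using \<zeta> by (intro eventually_at_left_real) auto
    then show "\<forall>\<^sub>F s in at_left 1. 0 \<le> \<Phi> (x T) (y T) (\<zeta>\<^sub>1 / of_real s) (\<zeta>\<^sub>2 / of_real s)"
      by eventually_elim (auto intro: step)
  qed simp
  then show ?thesis by (simp add: \<Phi>_def)
qed

end

section \<open>Differentiating the contraction property at time 0\<close>

lemma right_derivative_nonneg:
  fixes f :: "real \<Rightarrow> real"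
  assumes "(f has_real_derivative l) (at 0 within {0..})" "f 0 = 0" "\<And>t. 0 < t \<Longrightarrow> 0 \<le> f t"
  shows "0 \<le> l"
proof (rule ccontr)
  assume "\<not> 0 \<le> l"
  then obtain d where d: "0 < d" "\<forall>h>0. 0 + h \<in> {0..} \<longrightarrow> h < d \<longrightarrow> f (0 + h) < f 0"
    using has_real_derivative_neg_dec_right [OF assms(1)] by force
  then have "f (d / 2) < 0" using assms(2) by auto
  then show False using assms(3) [of "d / 2"] d(1) by simp
qed

lemma has_real_derivative_cmod_sq:
  fixes f :: "real \<Rightarrow> complex"
  assumes "(f has_vector_derivative f') (at t within S)"
  shows "((\<lambda>t. (cmod (f t))\<^sup>2) has_real_derivative 2 * Re (cnj (f t) * f')) (at t within S)"
proof -
  have "((\<lambda>t. f t * cnj (f t)) has_vector_derivative (f t * cnj f' + f' * cnj (f t))) (at t within S)"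
    by (intro derivative_intros assms)
  then have "((\<lambda>t. Re (f t * cnj (f t))) has_vector_derivative Re (f t * cnj f' + f' * cnj (f t))) (at t within S)"
    by (rule bounded_linear.has_vector_derivative [OF bounded_linear_Re])
  moreover have "(\<lambda>t. Re (f t * cnj (f t))) = (\<lambda>t. (cmod (f t))\<^sup>2)"
    unfolding cmod_power2 by (simp add: power2_eq_square)
  moreover have "Re (f t * cnj f' + f' * cnj (f t)) = 2 * Re (cnj (f t) * f')"
    by simp
  ultimately show ?thesis
    unfolding has_real_derivative_iff_has_vector_derivative by (simp only:)
qed

text \<open>The infinitesimal form of the fact that the flow contracts the hyperbolic distance.\<close>

theorem generator_two_point_inequality:
  fixes G :: "complex ^ 'n::finite \<Rightarrow> complex ^ 'n"
  assumes gen: "infinitesimal_generator G" and z: "norm z < 1" and w: "norm w < 1" and "z \<noteq> w"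
  shows "(z \<bullet> G z) / (1 - (norm z)\<^sup>2) + (w \<bullet> G w) / (1 - (norm w)\<^sup>2)
    \<le> Re ((cinner (G z) w + cnj (cinner (G w) z)) / (1 - cinner z w))"
proof -
  \<comment> \<open>\<open>c\<close> is the point nearest to the origin on the complex line through
    \<open>z\<close> and \<open>w\<close>; \<open>\<rho>\<close> will be the radius of the disc that
    this line cuts out of the ball.\<close>
  define v where "v = of_real (1 / norm (z - w)) *s (z - w)"
  define c where "c = z - cinner z v *s v"
  have v: "norm v = 1" using \<open>z \<noteq> w\<close> unfolding v_def norm_scale_vec by (simp add: norm_divide)
  have vv: "cinner v v = 1" using v by (simp add: cinner_self)
  have orth: "cinner c v = 0" by (simp add: c_def cinner_diff_left cinner_scale_left vv)
  have orth': "cinner v c = 0" using orth cinner_cnj [of c v] by simp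
  have zc: "z = c + cinner z v *s v" by (simp add: c_def)
  have wc: "w = c + cinner w v *s v"
  proof -
    have "z - w = of_real (norm (z - w)) *s v" using \<open>z \<noteq> w\<close> unfolding v_def vector_smult_assoc by simp
    then have "z - w = cinner (z - w) v *s v" by (metis cinner_scale_left mult.right_neutral vv)
    then have "z - w = cinner z v *s v - cinner w v *s v"
      by (simp add: cinner_diff_left vec_eq_iff algebra_simps)
    then show ?thesis unfolding c_def by (simp add: algebra_simps)
  qed
  have "(norm z)\<^sup>2 = (norm c)\<^sup>2 + (cmod (cinner z v))\<^sup>2"
  proof -
    have "cinner z z = cinner c c + cinner z v * cnj (cinner z v)"
      by (subst (1 2) zc) (simp add: cinner_add_left cinner_add_right cinner_scale_left cinner_scale_right orth orth' vv)
    then show ?thesis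
      unfolding cinner_self complex_norm_square [symmetric] by (metis of_real_add of_real_eq_iff)
  qed
  then have "(norm c)\<^sup>2 \<le> (norm z)\<^sup>2" by simp
  then have c1: "norm c < 1" using z by (meson le_less_trans norm_ge_zero power2_le_imp_le)
  then have c2: "(norm c)\<^sup>2 < 1" by (simp add: abs_square_less_1)
  define \<rho> where "\<rho> = sqrt (1 - (norm c)\<^sup>2)"
  have \<rho>: "0 < \<rho>" "\<rho>\<^sup>2 = 1 - (norm c)\<^sup>2" using c2 by (auto simp: \<rho>_def)
  interpret geodesic_disc c v \<rho>
    by unfold_locales (use v orth c1 \<rho> in auto)
  define \<zeta>\<^sub>1 \<zeta>\<^sub>2 where "\<zeta>\<^sub>1 = cinner z v / of_real \<rho>" and "\<zeta>\<^sub>2 = cinner w v / of_real \<rho>"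
  have pz: "pt \<zeta>\<^sub>1 = z" and pw: "pt \<zeta>\<^sub>2 = w"
    using zc wc \<rho>(1) by (auto simp: pt_def \<zeta>\<^sub>1_def \<zeta>\<^sub>2_def)
  have Nz: "1 - (norm z)\<^sup>2 = \<rho>\<^sup>2 * (1 - (cmod \<zeta>\<^sub>1)\<^sup>2)" and Nw: "1 - (norm w)\<^sup>2 = \<rho>\<^sup>2 * (1 - (cmod \<zeta>\<^sub>2)\<^sup>2)"
    using norm_pt [of \<zeta>\<^sub>1] norm_pt [of \<zeta>\<^sub>2] by (auto simp: pz pw)
  have Nz0: "0 < 1 - (norm z)\<^sup>2" and Nw0: "0 < 1 - (norm w)\<^sup>2"
    using z w by (auto simp: abs_square_less_1)
  have "0 < 1 - (cmod \<zeta>\<^sub>1)\<^sup>2" "0 < 1 - (cmod \<zeta>\<^sub>2)\<^sup>2"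
    using Nz0 Nw0 unfolding Nz Nw by (auto simp: zero_less_mult_iff)
  then have \<zeta>: "cmod \<zeta>\<^sub>1 < 1" "cmod \<zeta>\<^sub>2 < 1" by (auto simp: abs_square_less_1)
  obtain x where x: "x 0 = z" "trajectory G x"
    by (rule generator_trajectory [OF gen, of z]) (use z in auto)
  obtain y where y: "y 0 = w" "trajectory G y"
    by (rule generator_trajectory [OF gen, of w]) (use w in auto)
  have x0: "(x has_vector_derivative G z) (at 0 within {0..})" and y0: "(y has_vector_derivative G w) (at 0 within {0..})"
    using x y by (auto simp: trajectory_def)
  define \<kappa> where "\<kappa> = 1 - cinner z w"
  have \<kappa>\<zeta>: "\<kappa> = of_real (\<rho>\<^sup>2) * (1 - \<zeta>\<^sub>1 * cnj \<zeta>\<^sub>2)"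
    using cinner_pt [of \<zeta>\<^sub>1 \<zeta>\<^sub>2] by (simp add: \<kappa>_def pz pw)
  define S\<^sub>1 where "S\<^sub>1 t = (cmod (den (x t)))\<^sup>2 - (cmod (num (x t)))\<^sup>2" for t
  define S\<^sub>2 where "S\<^sub>2 t = (cmod (den (y t)))\<^sup>2 - (cmod (num (y t)))\<^sup>2" for t
  define K where "K t = den (x t) * cnj (den (y t)) - num (x t) * cnj (num (y t))" for t
  \<comment> \<open>\<open>\<Psi>\<close> is nonnegative at positive times by contraction and
    vanishes at time 0, where the left inverse returns \<open>\<zeta>\<^sub>1\<close> and
    \<open>\<zeta>\<^sub>2\<close>. Hence its right derivative at 0 is nonnegative, and this is the
    desired inequality with denominators cleared.\<close>
  define \<Psi> where "\<Psi> t = (cmod (1 - cnj \<zeta>\<^sub>2 * \<zeta>\<^sub>1))\<^sup>2 * (S\<^sub>1 t * S\<^sub>2 t) - (cmod (K t))\<^sup>2 * ((1 - (cmod \<zeta>\<^sub>1)\<^sup>2) * (1 - (cmod \<zeta>\<^sub>2)\<^sup>2))" for t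
  have pos: "0 \<le> \<Psi> t" if "0 < t" for t
    using Schwarz_Pick_flow [OF gen _ x(2) _ y(2) \<zeta> that] x(1) y(1)
    by (simp add: \<Psi>_def S\<^sub>1_def S\<^sub>2_def K_def pz pw)
  define A where "A = cinner (G z) w + cnj (cinner (G w) z)"
  have at0: "num (x 0) = of_real (\<rho>\<^sup>2) * \<zeta>\<^sub>1" "den (x 0) = of_real (\<rho>\<^sup>2)"
    "num (y 0) = of_real (\<rho>\<^sup>2) * \<zeta>\<^sub>2" "den (y 0) = of_real (\<rho>\<^sup>2)"
    using num_pt den_pt x(1) y(1) pz pw by metis+
  have S0: "S\<^sub>1 0 = \<rho>\<^sup>2 * (1 - (norm z)\<^sup>2)" "S\<^sub>2 0 = \<rho>\<^sup>2 * (1 - (norm w)\<^sup>2)"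
    unfolding S\<^sub>1_def S\<^sub>2_def at0 Nz Nw
    by (simp_all add: norm_mult power_mult_distrib algebra_simps norm_power power2_eq_square)
  have K0: "K 0 = of_real (\<rho>\<^sup>2) * \<kappa>"
    unfolding K_def at0 \<kappa>\<zeta> by (simp add: algebra_simps)
  have lin: "((\<lambda>t. cinner (x t) u) has_vector_derivative cinner (G z) u) (at 0 within {0..})"
      "((\<lambda>t. cinner (y t) u) has_vector_derivative cinner (G w) u) (at 0 within {0..})" for u
    using bounded_linear.has_vector_derivative [OF bounded_linear_cinner x0]
      bounded_linear.has_vector_derivative [OF bounded_linear_cinner y0] x(1) y(1) by simp_all
  have dn: "((\<lambda>t. num (x t)) has_vector_derivative of_real \<rho> * cinner (G z) v) (at 0 within {0..})"
      "((\<lambda>t. num (y t)) has_vector_derivative of_real \<rho> * cinner (G w) v) (at 0 within {0..})"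
    unfolding num_def by (intro has_vector_derivative_mult_right lin)+
  have dd: "((\<lambda>t. den (x t)) has_vector_derivative - cinner (G z) c) (at 0 within {0..})"
      "((\<lambda>t. den (y t)) has_vector_derivative - cinner (G w) c) (at 0 within {0..})"
    unfolding den_def using has_vector_derivative_diff [OF has_vector_derivative_const lin(1)]
      has_vector_derivative_diff [OF has_vector_derivative_const lin(2)] by simp_all
  \<comment> \<open>Expanding \<open>z\<close> and \<open>w\<close> along \<open>c\<close> and
    \<open>v\<close> recombines the derivatives of \<open>num\<close> and \<open>den\<close> into
    products with \<open>z\<close> and \<open>w\<close> themselves.\<close>
  have split: "cinner u z = cinner u c + of_real \<rho> * cnj \<zeta>\<^sub>1 * cinner u v"
      "cinner u w = cinner u c + of_real \<rho> * cnj \<zeta>\<^sub>2 * cinner u v" for u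
    using pz pw by (auto simp: pt_def cinner_add_right cinner_scale_right)
  have zG: "z \<bullet> G z = Re (cinner (G z) z)" "w \<bullet> G w = Re (cinner (G w) w)"
    by (simp_all add: Re_cinner inner_commute)
  have dS1: "(S\<^sub>1 has_real_derivative - 2 * \<rho>\<^sup>2 * (z \<bullet> G z)) (at 0 within {0..})"
    unfolding S\<^sub>1_def
    by (rule DERIV_cong [OF DERIV_diff [OF has_real_derivative_cmod_sq [OF dd(1)] has_real_derivative_cmod_sq [OF dn(1)]]])
      (simp add: at0 zG(1) split(1) algebra_simps power2_eq_square)
  have dS2: "(S\<^sub>2 has_real_derivative - 2 * \<rho>\<^sup>2 * (w \<bullet> G w)) (at 0 within {0..})"
    unfolding S\<^sub>2_def
    by (rule DERIV_cong [OF DERIV_diff [OF has_real_derivative_cmod_sq [OF dd(2)] has_real_derivative_cmod_sq [OF dn(2)]]])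
      (simp add: at0 zG(2) split(2) algebra_simps power2_eq_square)
  have "(K has_vector_derivative (den (x 0) * cnj (- cinner (G w) c) + (- cinner (G z) c) * cnj (den (y 0))
       - (num (x 0) * cnj (of_real \<rho> * cinner (G w) v) + (of_real \<rho> * cinner (G z) v) * cnj (num (y 0))))) (at 0 within {0..})"
    unfolding K_def
    by (intro has_vector_derivative_diff has_vector_derivative_mult has_vector_derivative_cnj dd dn)
  moreover have "den (x 0) * cnj (- cinner (G w) c) + (- cinner (G z) c) * cnj (den (y 0))
       - (num (x 0) * cnj (of_real \<rho> * cinner (G w) v) + (of_real \<rho> * cinner (G z) v) * cnj (num (y 0))) = - of_real (\<rho>\<^sup>2) * A"
    by (simp add: at0 A_def split algebra_simps power2_eq_square)
  ultimately have dK: "(K has_vector_derivative - of_real (\<rho>\<^sup>2) * A) (at 0 within {0..})" by simp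
  have "(\<Psi> has_real_derivative (cmod (1 - cnj \<zeta>\<^sub>2 * \<zeta>\<^sub>1))\<^sup>2 * (- 2 * \<rho>\<^sup>2 * (z \<bullet> G z) * S\<^sub>2 0 + - 2 * \<rho>\<^sup>2 * (w \<bullet> G w) * S\<^sub>1 0)
     - 2 * Re (cnj (K 0) * (- of_real (\<rho>\<^sup>2) * A)) * ((1 - (cmod \<zeta>\<^sub>1)\<^sup>2) * (1 - (cmod \<zeta>\<^sub>2)\<^sup>2))) (at 0 within {0..})"
    unfolding \<Psi>_def
    by (intro DERIV_diff DERIV_cmult DERIV_cmult_right DERIV_mult dS1 dS2 has_real_derivative_cmod_sq dK)
  moreover have "\<Psi> 0 = 0"
  proof -
    have "cmod (1 - \<zeta>\<^sub>1 * cnj \<zeta>\<^sub>2) = cmod (1 - cnj \<zeta>\<^sub>2 * \<zeta>\<^sub>1)" by (simp add: mult.commute)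
    then show ?thesis
      unfolding \<Psi>_def S0 K0 Nz Nw \<kappa>\<zeta> by (simp add: norm_mult power_mult_distrib mult_ac norm_power)
  qed
  ultimately have "0 \<le> (cmod (1 - cnj \<zeta>\<^sub>2 * \<zeta>\<^sub>1))\<^sup>2 * (- 2 * \<rho>\<^sup>2 * (z \<bullet> G z) * S\<^sub>2 0 + - 2 * \<rho>\<^sup>2 * (w \<bullet> G w) * S\<^sub>1 0)
     - 2 * Re (cnj (K 0) * (- of_real (\<rho>\<^sup>2) * A)) * ((1 - (cmod \<zeta>\<^sub>1)\<^sup>2) * (1 - (cmod \<zeta>\<^sub>2)\<^sup>2))"
    using pos by (rule right_derivative_nonneg)
  \<comment> \<open>All powers of \<open>\<rho>\<close> are absorbed by \<open>\<kappa>\<close>,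
    \<open>1 - (norm z)\<^sup>2\<close> and \<open>1 - (norm w)\<^sup>2\<close>, so the auxiliary
    disc disappears from the result.\<close>
  also have "\<dots> = 2 * ((cmod \<kappa>)\<^sup>2 * (- (z \<bullet> G z) * (1 - (norm w)\<^sup>2) - (w \<bullet> G w) * (1 - (norm z)\<^sup>2))
      + Re (cnj \<kappa> * A) * ((1 - (norm z)\<^sup>2) * (1 - (norm w)\<^sup>2)))"
  proof -
    have k: "(cmod \<kappa>)\<^sup>2 = (\<rho>\<^sup>2)\<^sup>2 * (cmod (1 - cnj \<zeta>\<^sub>2 * \<zeta>\<^sub>1))\<^sup>2"
      unfolding \<kappa>\<zeta> by (simp add: norm_mult power_mult_distrib mult.commute norm_power)
    have r: "Re (cnj (K 0) * (- of_real (\<rho>\<^sup>2) * A)) = - (\<rho>\<^sup>2)\<^sup>2 * Re (cnj \<kappa> * A)"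
      unfolding K0 by (simp add: algebra_simps power2_eq_square)
    show ?thesis
      unfolding k S0 Nz Nw r by (simp add: algebra_simps power2_eq_square)
  qed
  finally have key: "(cmod \<kappa>)\<^sup>2 * ((z \<bullet> G z) * (1 - (norm w)\<^sup>2) + (w \<bullet> G w) * (1 - (norm z)\<^sup>2))
      \<le> Re (cnj \<kappa> * A) * ((1 - (norm z)\<^sup>2) * (1 - (norm w)\<^sup>2))"
    by (simp add: algebra_simps)
  have k0: "\<kappa> \<noteq> 0" unfolding \<kappa>_def by (rule one_minus_cinner_nonzero) (use z w in auto)
  have "Re (A / \<kappa>) = Re (cnj \<kappa> * A) / (cmod \<kappa>)\<^sup>2"
    by (simp add: Re_divide cmod_power2 algebra_simps)
  moreover have "(z \<bullet> G z) / (1 - (norm z)\<^sup>2) + (w \<bullet> G w) / (1 - (norm w)\<^sup>2)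
      = ((z \<bullet> G z) * (1 - (norm w)\<^sup>2) + (w \<bullet> G w) * (1 - (norm z)\<^sup>2)) / ((1 - (norm z)\<^sup>2) * (1 - (norm w)\<^sup>2))"
    using Nz0 Nw0 by (intro add_frac_eq) auto
  moreover have "\<dots> \<le> Re (cnj \<kappa> * A) / (cmod \<kappa>)\<^sup>2"
  proof -
    have "0 < (1 - (norm z)\<^sup>2) * (1 - (norm w)\<^sup>2)" "0 < (cmod \<kappa>)\<^sup>2" using Nz0 Nw0 k0 by simp_all
    then show ?thesis using key by (simp only: pos_divide_le_eq times_divide_eq_left times_divide_eq_right pos_le_divide_eq mult.commute)
  qed
  ultimately show ?thesis by (simp add: A_def \<kappa>_def)
qed

section \<open>The dilation as a radial limit\<close>

lemma norm_nth_less_one: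
  fixes z :: "complex ^ 'n::finite"
  assumes "norm z < 1"
  shows "cmod (z $ a) < 1"
  using Finite_Cartesian_Product.norm_nth_le [of z a] assms by simp

lemma one_minus_nth_nonzero:
  fixes z :: "complex ^ 'n::finite"
  assumes "norm z < 1"
  shows "1 - z $ a \<noteq> 0"
  using norm_nth_less_one [OF assms, of a] by auto

lemma u_ball_neg:
  assumes "norm z < 1"
  shows "u_ball a z < 0"
proof -
  have "0 < 1 - (norm z)\<^sup>2" using assms by (simp add: abs_square_less_1)
  then show ?thesis
    using one_minus_nth_nonzero [OF assms, of a] by (simp add: u_ball_def divide_neg_pos)
qed

text \<open>Along the real line through \<open>z\<close> the function is \<open>- N / D\<close>, so
  the quotient is the logarithmic derivative \<open>N' / N - D' / D\<close>.\<close>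

lemma du_ball_quotient:
  assumes "norm z < 1"
  shows "du_ball a z w / u_ball a z = - 2 * (z \<bullet> w) / (1 - (norm z)\<^sup>2) + 2 * Re (w $ a / (1 - z $ a))"
proof -
  define N where "N t = 1 - (norm (z + t *\<^sub>R w))\<^sup>2" for t
  define D where "D t = (cmod (1 - z $ a - of_real t * w $ a))\<^sup>2" for t :: real
  have nz: "1 - z $ a \<noteq> 0" by (rule one_minus_nth_nonzero [OF assms])
  have "N = (\<lambda>t. 1 - ((norm z)\<^sup>2 + 2 * t * (z \<bullet> w) + t\<^sup>2 * (norm w)\<^sup>2))"
    by (rule ext) (simp only: N_def power2_norm_eq_inner inner_add_left inner_add_right inner_scaleR_left
        inner_scaleR_right inner_commute [of w z], simp add: power2_eq_square algebra_simps)
  then have dN: "(N has_real_derivative - 2 * (z \<bullet> w)) (at 0)"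
    by (auto intro!: derivative_eq_intros)
  have "((\<lambda>t::real. 1 - z $ a - of_real t * w $ a) has_vector_derivative - w $ a) (at 0)"
    by (auto intro!: derivative_eq_intros)
  from has_real_derivative_cmod_sq [OF this]
  have dD: "(D has_real_derivative 2 * Re (cnj (1 - z $ a) * (- w $ a))) (at 0)"
    unfolding D_def by simp
  have D0: "D 0 = (cmod (1 - z $ a))\<^sup>2" "D 0 \<noteq> 0" using nz by (auto simp: D_def)
  have N0: "N 0 = 1 - (norm z)\<^sup>2" "N 0 \<noteq> 0"
    using assms abs_square_less_1 [of "norm z"] by (auto simp: N_def)
  have "(z + t *\<^sub>R w) $ a = z $ a + of_real t * w $ a" for t
    by (simp add: scaleR_conv_of_real [of t "w $ a"])
  then have ueq: "(\<lambda>t. u_ball a (z + t *\<^sub>R w)) = (\<lambda>t. - (N t / D t))"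
    unfolding u_ball_def N_def D_def by (simp only: minus_divide_left diff_diff_eq)
  have dq: "((\<lambda>t. - (N t / D t)) has_real_derivative
      - ((- 2 * (z \<bullet> w) * D 0 - N 0 * (2 * Re (cnj (1 - z $ a) * (- w $ a)))) / (D 0 * D 0))) (at 0)"
    by (intro DERIV_minus DERIV_divide dN dD D0)
  have du: "du_ball a z w = - ((- 2 * (z \<bullet> w) * D 0 + N 0 * (2 * Re (cnj (1 - z $ a) * w $ a))) / (D 0 * D 0))"
    unfolding du_ball_def ueq DERIV_imp_deriv [OF dq] by (simp add: algebra_simps)
  have u: "u_ball a z = - (N 0 / D 0)" using fun_cong [OF ueq, of 0] by simp
  have "Re (w $ a / (1 - z $ a)) = Re (cnj (1 - z $ a) * w $ a) / D 0"
    unfolding D0(1) by (simp add: Re_divide cmod_power2 algebra_simps)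
  moreover have "du_ball a z w / u_ball a z = - 2 * (z \<bullet> w) / N 0 + 2 * (Re (cnj (1 - z $ a) * w $ a) / D 0)"
    unfolding du u using D0(2) N0(2) by (simp add: field_simps)
  ultimately show ?thesis by (simp add: N0(1))
qed

text \<open>Comparing \<open>w\<close> with \<open>|w|\<close> is Harnack's inequality for \<open>Re P\<close>, comparing it with \<open>0\<close> controls
  \<open>|P|\<^sup>2\<close> by \<open>Re P\<close>.\<close>

lemma nontangential_limit_from_radial:
  assumes hol: "P holomorphic_on ball 0 1" and pos: "\<And>z. cmod z < 1 \<Longrightarrow> 0 < Re (P z)"
    and rad: "((\<lambda>r. (1 - r) * Re (P (of_real r))) \<longlongrightarrow> 0) (at_left 1)"
    and M: "0 \<le> M" and "0 < \<epsilon>"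
  obtains \<delta> where "0 < \<delta>"
    "\<And>w. cmod w < 1 \<Longrightarrow> cmod (1 - w) < \<delta> \<Longrightarrow> cmod (1 - w) \<le> M * (1 - cmod w) \<Longrightarrow> cmod ((1 - w) * P w) < \<epsilon>"
proof -
  \<comment> \<open>One factor 4 comes from the half-plane inequality at the point 0, the other
    together with \<open>(M + 1)\<^sup>2\<close> from \<open>harnack\<close>. The function
    \<open>h\<close> majorizes \<open>cmod ((1 - w) * P w)\<close> for
    \<open>r = cmod w\<close>.\<close>
  define C where "C = 16 * Re (P 0) * (M + 1)\<^sup>2"
  define h where "h r = M * (sqrt (C * ((1 - r) * Re (P (of_real r)))) + (1 - r) * cmod (P 0))" for r
  have "(h \<longlongrightarrow> M * (sqrt (C * 0) + (1 - 1) * cmod (P 0))) (at_left 1)"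
    unfolding h_def by (intro tendsto_intros rad)
  then have "\<forall>\<^sub>F r in at_left 1. h r < \<epsilon>"
    using \<open>0 < \<epsilon>\<close> by (intro order_tendstoD(2)) auto
  then obtain b where b: "b < 1" "\<And>r. b < r \<Longrightarrow> r < 1 \<Longrightarrow> h r < \<epsilon>"
    by (auto simp: eventually_at_left [of 0])
  show ?thesis
  proof
    show "0 < 1 - b" using b by simp
    fix w assume w: "cmod w < 1" and close: "cmod (1 - w) < 1 - b" and nt: "cmod (1 - w) \<le> M * (1 - cmod w)"
    define r where "r = cmod w"
    have r: "0 \<le> r" "r < 1" using w by (auto simp: r_def)
    have "1 - r \<le> cmod (1 - w)" unfolding r_def using norm_triangle_ineq2 [of 1 w] by simp
    then have hr: "h r < \<epsilon>" using close r by (intro b(2)) auto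
    have q: "1 - r \<le> 1 - r\<^sup>2" using r by (simp add: power2_eq_square mult_left_le)
    have rr: "cmod (complex_of_real r) < 1" using r by simp
    \<comment> \<open>The aperture condition gives
      \<open>cmod (1 - r * w) \<le> (M + 1) * (1 - r)\<close>: the points \<open>w\<close> and
      \<open>r\<close> stay within bounded hyperbolic distance, and \<open>(1 - r)\<^sup>2\<close>
      cancels.\<close>
    have harnack: "Re (P w) \<le> 4 * (M + 1)\<^sup>2 * Re (P (of_real r))"
    proof -
      have "cmod (1 - of_real r * w) \<le> (M + 1) * (1 - r)"
      proof -
        have eq: "1 - of_real r * w = (1 - w) + of_real (1 - r) * w" by (simp add: algebra_simps)
        have "cmod (1 - of_real r * w) \<le> cmod (1 - w) + (1 - r) * r"
          unfolding eq using norm_triangle_ineq [of "1 - w" "of_real (1 - r) * w"] r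
          by (simp add: norm_mult r_def del: of_real_diff)
        also have "\<dots> \<le> M * (1 - r) + (1 - r) * 1"
          using nt r by (intro add_mono mult_left_mono) (auto simp: r_def)
        finally show ?thesis by (simp add: algebra_simps)
      qed
      then have k: "(cmod (1 - of_real r * w))\<^sup>2 \<le> (M + 1)\<^sup>2 * (1 - r)\<^sup>2"
        by (metis norm_ge_zero power_mono power_mult_distrib)
      have "(Re (P w))\<^sup>2 * (1 - r)\<^sup>2 \<le> (cmod (P w + cnj (P (of_real r))))\<^sup>2 * ((1 - r\<^sup>2) * (1 - r\<^sup>2))"
      proof (rule mult_mono)
        have "Re (P w) \<le> Re (P w + cnj (P (of_real r)))" using pos [OF rr] by simp
        also have "\<dots> \<le> cmod (P w + cnj (P (of_real r)))" by (rule complex_Re_le_cmod)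
        finally show "(Re (P w))\<^sup>2 \<le> (cmod (P w + cnj (P (of_real r))))\<^sup>2"
          using pos [OF w] by (intro power_mono) auto
        show "(1 - r)\<^sup>2 \<le> (1 - r\<^sup>2) * (1 - r\<^sup>2)"
          unfolding power2_eq_square [of "1 - r"] using q r by (intro mult_mono) auto
      qed auto
      also have "\<dots> \<le> 4 * (cmod (1 - of_real r * w))\<^sup>2 * (Re (P w) * Re (P (of_real r)))"
        using halfplane_Schwarz_Pick [OF hol pos w rr] r by (simp add: r_def [symmetric])
      also have "\<dots> \<le> 4 * ((M + 1)\<^sup>2 * (1 - r)\<^sup>2) * (Re (P w) * Re (P (of_real r)))"
        using k pos [OF w] pos [OF rr] by (intro mult_right_mono mult_left_mono) auto
      finally have "(1 - r)\<^sup>2 * Re (P w) * Re (P w) \<le> (1 - r)\<^sup>2 * Re (P w) * (4 * (M + 1)\<^sup>2 * Re (P (of_real r)))"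
        by (simp add: power2_eq_square mult_ac)
      moreover have "0 < (1 - r)\<^sup>2 * Re (P w)" using r pos [OF w] by simp
      ultimately show ?thesis by (simp only: mult_le_cancel_left_pos)
    qed
    have "((1 - r) * cmod (P w + cnj (P 0)))\<^sup>2 \<le> C * ((1 - r) * Re (P (of_real r)))"
    proof -
      have "(cmod (P w + cnj (P 0)))\<^sup>2 * (1 - r) \<le> (cmod (P w + cnj (P 0)))\<^sup>2 * (1 - r\<^sup>2)"
        using q by (intro mult_left_mono) auto
      also have "\<dots> \<le> 4 * (Re (P w) * Re (P 0))"
        using halfplane_Schwarz_Pick [OF hol pos w, of 0] by (simp add: r_def)
      also have "\<dots> \<le> 4 * ((4 * (M + 1)\<^sup>2 * Re (P (of_real r))) * Re (P 0))"
        using harnack pos [of 0] by (intro mult_left_mono mult_right_mono) auto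
      finally have "(1 - r) * ((cmod (P w + cnj (P 0)))\<^sup>2 * (1 - r)) \<le> (1 - r) * (4 * ((4 * (M + 1)\<^sup>2 * Re (P (of_real r))) * Re (P 0)))"
        using r by (intro mult_left_mono) auto
      then show ?thesis by (simp add: C_def power2_eq_square mult_ac)
    qed
    then have s: "(1 - r) * cmod (P w + cnj (P 0)) \<le> sqrt (C * ((1 - r) * Re (P (of_real r))))"
      by (rule real_le_rsqrt)
    have "cmod (P w) \<le> cmod (P w + cnj (P 0)) + cmod (P 0)"
      using norm_triangle_ineq4 [of "P w + cnj (P 0)" "cnj (P 0)"] by simp
    then have "(1 - r) * cmod (P w) \<le> (1 - r) * (cmod (P w + cnj (P 0)) + cmod (P 0))"
      using r by (intro mult_left_mono) auto
    then have "(1 - r) * cmod (P w) \<le> sqrt (C * ((1 - r) * Re (P (of_real r)))) + (1 - r) * cmod (P 0)"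
      using s by (simp add: distrib_left)
    then have "M * ((1 - r) * cmod (P w)) \<le> h r"
      unfolding h_def using M by (intro mult_left_mono)
    moreover have "cmod ((1 - w) * P w) \<le> M * (1 - r) * cmod (P w)"
      unfolding norm_mult using nt by (intro mult_right_mono) (auto simp: r_def)
    ultimately show "cmod ((1 - w) * P w) < \<epsilon>" using hr by (simp add: mult.assoc)
  qed
qed

lemma bounded_on_koranyi_quotient:
  assumes "bounded_on_koranyi a (\<lambda>z. f z / k z)" "1 \<le> R" "\<And>z. z \<in> ball 0 1 \<Longrightarrow> 0 < k z"
  obtains M where "0 \<le> M" "\<And>z. z \<in> koranyi a R \<Longrightarrow> f z \<le> M * k z"
proof -
  obtain M where M: "\<And>z. z \<in> koranyi a R \<Longrightarrow> \<bar>f z / k z\<bar> \<le> M"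
    using assms(1,2) unfolding bounded_on_koranyi_def by blast
  show ?thesis
  proof
    \<comment> \<open>The given bound can be negative when the region is empty, as it is for
      \<open>R = 1\<close>.\<close>
    show "0 \<le> max M 0" by simp
    fix z assume z: "z \<in> koranyi a R"
    then have k: "0 < k z" using assms(3) by (simp add: koranyi_def)
    have "f z / k z \<le> max M 0" using M [OF z] by linarith
    then show "f z \<le> max M 0 * k z" using k by (simp add: pos_divide_le_eq)
  qed
qed

lemma norm_scale_cbasis [simp]: "norm (c *s cbasis a :: complex ^ 'n::finite) = cmod c"
  by (simp add: norm_scale_vec cbasis_def)

lemma norm_cbasis [simp]: "norm (cbasis a) = 1"
  by (simp add: cbasis_def norm_axis_1)

lemma cbasis_nth [simp]: "cbasis a $ j = (if j = a then 1 else 0)"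
  by (simp add: cbasis_def axis_def)

lemma cmod_one_minus_of_real:
  assumes "r \<le> 1"
  shows "cmod (1 - of_real r) = 1 - r"
  using norm_of_real [of "1 - r", where 'a = complex] assms by simp

section \<open>Radial behaviour under the hypotheses of the theorem\<close>

locale koranyi_generator =
  fixes G :: "complex ^ 'n::finite \<Rightarrow> complex ^ 'n" and a :: 'n
  assumes gen: "infinitesimal_generator G"
    and H1: "bounded_on_koranyi a (\<lambda>z. cmod (G z $ a) / cmod (z $ a - 1))"
    and H2: "\<And>j. j \<noteq> a \<Longrightarrow> bounded_on_koranyi a (\<lambda>z. cmod (G z $ j) / sqrt (cmod (z $ a - 1)))"
begin

lemma hol: "holomorphic_vec_on G (ball 0 1)"
  using gen by (simp add: infinitesimal_generator_def)

lemma normal_bound: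
  assumes "1 \<le> R"
  obtains M where "0 \<le> M" "\<And>z. z \<in> koranyi a R \<Longrightarrow> cmod (G z $ a) \<le> M * cmod (1 - z $ a)"
proof -
  obtain M where "0 \<le> M" "\<And>z. z \<in> koranyi a R \<Longrightarrow> cmod (G z $ a) \<le> M * cmod (z $ a - 1)"
    by (rule bounded_on_koranyi_quotient [OF H1 assms]) (use one_minus_nth_nonzero in auto)
  then show ?thesis by (intro that) (auto simp: norm_minus_commute)
qed

lemma tangential_bound:
  assumes "1 \<le> R" "j \<noteq> a"
  obtains M where "0 \<le> M" "\<And>z. z \<in> koranyi a R \<Longrightarrow> cmod (G z $ j) \<le> M * sqrt (cmod (1 - z $ a))"
proof -
  obtain M where "0 \<le> M" "\<And>z. z \<in> koranyi a R \<Longrightarrow> cmod (G z $ j) \<le> M * sqrt (cmod (z $ a - 1))"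
    by (rule bounded_on_koranyi_quotient [OF H2 [OF assms(2)] assms(1)]) (use one_minus_nth_nonzero in auto)
  then show ?thesis by (intro that) (auto simp: norm_minus_commute)
qed

definition slice :: "complex \<Rightarrow> complex" where "slice \<zeta> = G (\<zeta> *s cbasis a) $ a"

definition rate :: "complex ^ 'n \<Rightarrow> real" where "rate z = du_ball a z (G z) / u_ball a z"

text \<open>Only the real part is followed along the radius, since the two-point inequality contains
  only real parts. The imaginary part is settled afterwards by the half-plane inequality in
  \<open>slice_limit\<close>.\<close>

definition q :: "real \<Rightarrow> real" where "q r = Re (slice (of_real r)) / (r - 1)"

abbreviation \<beta> :: real where "\<beta> \<equiv> dilation a G"

text \<open>The condition amounts to \<open>2 \<le> R * (1 + r)\<close>, so 2 is the smallest
  aperture that serves for all \<open>r\<close> between 0 and 1.\<close>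

lemma radius_in_koranyi:
  assumes "0 < r" "r < 1"
  shows "of_real r *s cbasis a \<in> koranyi a 2"
  using assms by (auto simp: koranyi_def cmod_one_minus_of_real power2_eq_square mult_left_le)

lemma q_bounded:
  obtains C where "0 \<le> C" "\<And>r. 0 < r \<Longrightarrow> r < 1 \<Longrightarrow> \<bar>q r\<bar> \<le> C"
proof -
  obtain M where M: "0 \<le> M" "\<And>z. z \<in> koranyi a 2 \<Longrightarrow> cmod (G z $ a) \<le> M * cmod (1 - z $ a)"
    by (rule normal_bound [of 2]) auto
  show ?thesis
  proof
    show "0 \<le> M" by (rule M)
    fix r :: real assume r: "0 < r" "r < 1"
    have "\<bar>Re (slice (of_real r))\<bar> \<le> cmod (slice (of_real r))" by (rule abs_Re_le_cmod)
    also have "\<dots> \<le> M * cmod (of_real (1 - r))"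
      using M(2) [OF radius_in_koranyi [OF r]] by (simp add: slice_def)
    also have "\<dots> = M * (1 - r)" using r by (simp del: of_real_diff)
    finally show "\<bar>q r\<bar> \<le> M" using r by (simp add: q_def abs_divide divide_le_eq)
  qed
qed

text \<open>The normal component is of order \<open>1 - r\<close>, the others of order
  \<open>sqrt (1 - r)\<close>. This makes the product of \<open>G w\<close> with \<open>z\<close>
  vanish in the limit of the two-point inequality.\<close>

lemma radial_limit_zero: "((\<lambda>r. G (of_real r *s cbasis a)) \<longlongrightarrow> 0) (at_left 1)"
proof (rule vec_tendstoI)
  fix j
  have lim: "((\<lambda>r. 1 - r) \<longlongrightarrow> 1 - 1) (at_left (1::real))" by (intro tendsto_intros)
  have ev: "\<forall>\<^sub>F r in at_left (1::real). r \<in> {0<..<1}"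
    by (rule eventually_at_left_real) simp
  have eq: "cmod (1 - (of_real r *s cbasis a :: complex ^ 'n) $ a) = 1 - r" if "r < 1" for r :: real
    using that by (simp add: cmod_one_minus_of_real)
  show "((\<lambda>r. G (of_real r *s cbasis a) $ j) \<longlongrightarrow> 0 $ j) (at_left 1)"
  proof (cases "j = a")
    case True
    obtain M where M: "0 \<le> M" "\<And>z. z \<in> koranyi a 2 \<Longrightarrow> cmod (G z $ a) \<le> M * cmod (1 - z $ a)"
      by (rule normal_bound [of 2]) auto
    have "((\<lambda>r. G (of_real r *s cbasis a) $ j) \<longlongrightarrow> 0) (at_left 1)"
    proof (rule Lim_null_comparison)
      show "\<forall>\<^sub>F r in at_left 1. cmod (G (of_real r *s cbasis a) $ j) \<le> M * (1 - r)"
        using ev by eventually_elim (use M(2) [OF radius_in_koranyi] eq True in auto)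
      show "((\<lambda>r. M * (1 - r)) \<longlongrightarrow> 0) (at_left 1)"
        using tendsto_mult [OF tendsto_const lim, of M] by simp
    qed
    then show ?thesis by simp
  next
    case False
    obtain M where M: "0 \<le> M" "\<And>z. z \<in> koranyi a 2 \<Longrightarrow> cmod (G z $ j) \<le> M * sqrt (cmod (1 - z $ a))"
      by (rule tangential_bound [of 2 j]) (use False in auto)
    have "((\<lambda>r. G (of_real r *s cbasis a) $ j) \<longlongrightarrow> 0) (at_left 1)"
    proof (rule Lim_null_comparison)
      show "\<forall>\<^sub>F r in at_left 1. cmod (G (of_real r *s cbasis a) $ j) \<le> M * sqrt (1 - r)"
        using ev by eventually_elim (use M(2) [OF radius_in_koranyi] eq in auto)
      show "((\<lambda>r. M * sqrt (1 - r)) \<longlongrightarrow> 0) (at_left 1)"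
        using tendsto_mult [OF tendsto_const tendsto_real_sqrt [OF lim], of M] by simp
    qed
    then show ?thesis by simp
  qed
qed

lemma rate_eq:
  assumes "norm z < 1"
  shows "rate z = - 2 * (z \<bullet> G z) / (1 - (norm z)\<^sup>2) + 2 * Re (G z $ a / (1 - z $ a))"
  unfolding rate_def by (rule du_ball_quotient [OF assms])

text \<open>Twice the two-point inequality with \<open>w\<close> on the radius, everything except
  the term of \<open>w\<close> being collected in \<open>B\<close>. The bound is stated with
  \<open>B\<close> instead of a limit of \<open>q\<close> because so far \<open>q\<close> is only
  known to be bounded.\<close>

lemma rate_comparison:
  assumes z: "norm z < 1"
  obtains B where "(B \<longlongrightarrow> rate z) (at_left 1)" "\<forall>\<^sub>F r in at_left 1. - 2 * r * q r / (1 + r) \<le> B r"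
proof -
  define w :: "real \<Rightarrow> complex ^ 'n" where "w r = of_real r *s cbasis a" for r
  define B where "B r = 2 * Re ((of_real r * G z $ a + cnj (cinner (G (w r)) z)) / (1 - of_real r * z $ a))
      - 2 * (z \<bullet> G z) / (1 - (norm z)\<^sup>2)" for r
  have "(B \<longlongrightarrow> 2 * Re ((of_real 1 * G z $ a + cnj (cinner 0 z)) / (1 - of_real 1 * z $ a))
      - 2 * (z \<bullet> G z) / (1 - (norm z)\<^sup>2)) (at_left 1)"
    unfolding B_def w_def using one_minus_nth_nonzero [OF z, of a]
    by (intro tendsto_intros bounded_linear.tendsto [OF bounded_linear_cinner] radial_limit_zero) auto
  then have lim: "(B \<longlongrightarrow> rate z) (at_left 1)"
    by (simp add: rate_eq [OF z] cinner_def)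
  have "\<forall>\<^sub>F r in at_left (1::real). r \<in> {norm z<..<1}"
    by (rule eventually_at_left_real) (rule z)
  then have "\<forall>\<^sub>F r in at_left 1. - 2 * r * q r / (1 + r) \<le> B r"
  proof eventually_elim
    case (elim r)
    then have r: "0 < r" "r < 1" "norm z < r" using le_less_trans [OF norm_ge_zero, of z r] by auto
    have nw: "norm (w r) = r" using r by (simp add: w_def)
    then have "z \<noteq> w r" using r by auto
    from generator_two_point_inequality [OF gen z _ this] nw r
    have "(z \<bullet> G z) / (1 - (norm z)\<^sup>2) + (w r \<bullet> G (w r)) / (1 - r\<^sup>2)
      \<le> Re ((cinner (G z) (w r) + cnj (cinner (G (w r)) z)) / (1 - cinner z (w r)))" by simp
    moreover have "cinner x (w r) = of_real r * x $ a" for x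
      by (simp add: w_def cinner_scale_right)
    moreover have "w r \<bullet> G (w r) = r * Re (slice (of_real r))"
      using \<open>cinner (G (w r)) (w r) = of_real r * G (w r) $ a\<close> Re_cinner [of "G (w r)" "w r"]
      by (simp add: inner_commute slice_def w_def)
    moreover have "2 * (r * Re (slice (of_real r)) / (1 - r\<^sup>2)) = - 2 * r * q r / (1 + r)"
    proof -
      have e: "1 - r\<^sup>2 = - ((r - 1) * (1 + r))" by (simp add: power2_eq_square algebra_simps)
      show ?thesis unfolding e by (simp add: q_def)
    qed
    ultimately show ?case by (simp add: B_def)
  qed
  with lim show ?thesis by (rule that)
qed

lemma rate_bounded_below: "\<exists>C. \<forall>z\<in>ball 0 1. - C \<le> rate z"
proof -
  obtain C where C: "0 \<le> C" "\<And>r. 0 < r \<Longrightarrow> r < 1 \<Longrightarrow> \<bar>q r\<bar> \<le> C"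
    using q_bounded by blast
  have "- C \<le> rate z" if z: "norm z < 1" for z
  proof -
    obtain B where B: "(B \<longlongrightarrow> rate z) (at_left 1)" "\<forall>\<^sub>F r in at_left 1. - 2 * r * q r / (1 + r) \<le> B r"
      by (rule rate_comparison [OF z])
    have "\<forall>\<^sub>F r in at_left (1::real). r \<in> {0<..<1}" by (rule eventually_at_left_real) simp
    with B(2) have "\<forall>\<^sub>F r in at_left 1. - C \<le> B r"
    proof eventually_elim
      case (elim r)
      then have r: "0 < r" "r < 1" by auto
      have "2 * r * q r \<le> 2 * r * C" using C(2) [OF r] r by (intro mult_left_mono) auto
      also have "\<dots> \<le> (1 + r) * C" using r C(1) by (intro mult_right_mono) auto
      finally have "2 * r * q r / (1 + r) \<le> C" using r by (simp add: pos_divide_le_eq mult.commute)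
      then show ?case using elim by simp
    qed
    then show ?thesis by (rule tendsto_lowerbound [OF B(1)]) simp
  qed
  then have "\<forall>z\<in>ball 0 1. - C \<le> rate z" by simp
  then show ?thesis by blast
qed

lemma BRNP: "BRNP a G"
proof -
  obtain C where C: "\<And>z. z \<in> ball 0 1 \<Longrightarrow> - C \<le> rate z" using rate_bounded_below by blast
  show ?thesis
    unfolding BRNP_def
  proof (intro exI ballI)
    fix z :: "complex ^ 'n" assume z: "z \<in> ball 0 1"
    then have u: "u_ball a z < 0" by (intro u_ball_neg) simp
    \<comment> \<open>Multiplication by the negative \<open>u_ball a z\<close> turns the lower bound
      for \<open>rate\<close> into the required upper bound.\<close>
    have "rate z * u_ball a z \<le> - C * u_ball a z"
      using C [OF z] u by (intro mult_right_mono_neg) auto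
    then show "du_ball a z (G z) + C * u_ball a z \<le> 0"
      using u by (simp add: rate_def)
  qed
qed

lemma dilation_eq: "\<beta> = - (INF z\<in>ball 0 1. rate z)"
  by (simp add: dilation_def rate_def)

lemma rate_bdd_below: "bdd_below (rate ` ball 0 1)"
  using rate_bounded_below by (meson bdd_belowI2)

lemma rate_ge:
  assumes "norm z < 1"
  shows "- \<beta> \<le> rate z"
  unfolding dilation_eq using cINF_lower [OF rate_bdd_below, of z] assms by simp

text \<open>The two terms of \<open>rate\<close> merge because \<open>(1 - \<zeta>) * (1 - cnj
  \<zeta> * \<zeta>) - cnj \<zeta> * (1 - \<zeta>)\<^sup>2 = (1 - \<zeta>) * (1 - cnj
  \<zeta>)\<close>. The prefactor is twice the reciprocal Poisson kernel, so a lower bound for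
  \<open>rate\<close> becomes a sign condition on the real part of a holomorphic function.\<close>

lemma slice_rate:
  assumes "cmod \<zeta> < 1"
  shows "rate (\<zeta> *s cbasis a) = 2 * (cmod (1 - \<zeta>))\<^sup>2 / (1 - (cmod \<zeta>)\<^sup>2) * Re (slice \<zeta> / (1 - \<zeta>)\<^sup>2)"
proof -
  define m where "m = slice \<zeta> / (1 - \<zeta>)\<^sup>2"
  have nz: "1 - \<zeta> \<noteq> 0" using assms by auto
  have N: "0 < 1 - (cmod \<zeta>)\<^sup>2" using assms by (simp add: abs_square_less_1)
  have sm: "slice \<zeta> = m * (1 - \<zeta>)\<^sup>2" using nz by (simp add: m_def)
  have in_eq: "(\<zeta> *s cbasis a) \<bullet> G (\<zeta> *s cbasis a) = Re (cnj \<zeta> * slice \<zeta>)"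
    unfolding inner_commute [of "\<zeta> *s cbasis a" "G (\<zeta> *s cbasis a)"] unfolding Re_cinner [symmetric] cinner_scale_right by (simp add: slice_def)
  have "m * (1 - \<zeta>) * of_real (1 - (cmod \<zeta>)\<^sup>2) - cnj \<zeta> * slice \<zeta> = m * of_real ((cmod (1 - \<zeta>))\<^sup>2)"
    unfolding sm of_real_diff complex_norm_square by (simp add: algebra_simps power2_eq_square)
  then have "Re (m * (1 - \<zeta>) * of_real (1 - (cmod \<zeta>)\<^sup>2) - cnj \<zeta> * slice \<zeta>) = Re (m * of_real ((cmod (1 - \<zeta>))\<^sup>2))"
    by (rule arg_cong)
  then have id: "Re (m * (1 - \<zeta>)) * (1 - (cmod \<zeta>)\<^sup>2) - Re (cnj \<zeta> * slice \<zeta>) = Re m * (cmod (1 - \<zeta>))\<^sup>2"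
    unfolding minus_complex.sel Re_complex_of_real times_complex.sel(1)[of _ "complex_of_real _"] Im_complex_of_real by simp
  have gq: "slice \<zeta> / (1 - \<zeta>) = m * (1 - \<zeta>)" using nz by (simp add: sm power2_eq_square)
  have "rate (\<zeta> *s cbasis a) = - 2 * Re (cnj \<zeta> * slice \<zeta>) / (1 - (cmod \<zeta>)\<^sup>2) + 2 * Re (slice \<zeta> / (1 - \<zeta>))"
    using assms by (subst rate_eq) (auto simp only: in_eq norm_scale_cbasis vector_smult_component cbasis_nth slice_def if_True simp_thms mult_1_right)
  also have "\<dots> = 2 * (Re (m * (1 - \<zeta>)) * (1 - (cmod \<zeta>)\<^sup>2) - Re (cnj \<zeta> * slice \<zeta>)) / (1 - (cmod \<zeta>)\<^sup>2)"
  proof -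
    have common_denominator: "- 2 * u / n + 2 * v = 2 * (v * n - u) / n" if "n \<noteq> 0" for u v n :: real
      using that by (simp add: field_simps)
    show ?thesis unfolding gq by (rule common_denominator) (use N in simp)
  qed
  finally show ?thesis unfolding id m_def [symmetric] by simp
qed

lemma rate_radius:
  assumes "0 < r" "r < 1"
  shows "rate (of_real r *s cbasis a) = - 2 * q r / (1 + r)"
proof -
  define X where "X = Re (slice (of_real r))"
  have X: "Re (slice (of_real r) / (1 - of_real r)\<^sup>2) = X / (1 - r)\<^sup>2"
    unfolding X_def by (metis Re_divide_of_real of_real_1 of_real_diff of_real_power)
  have "rate (of_real r *s cbasis a) = 2 * (1 - r)\<^sup>2 / (1 - r\<^sup>2) * (X / (1 - r)\<^sup>2)"
    using assms slice_rate [of "of_real r"] by (simp add: X cmod_one_minus_of_real)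
  also have "\<dots> = 2 * X / (1 - r\<^sup>2)" using assms by simp
  also have "1 - r\<^sup>2 = - ((r - 1) * (1 + r))" by (simp add: power2_eq_square algebra_simps)
  finally show ?thesis by (simp add: q_def X_def)
qed

text \<open>The infimum supplies both halves: a point where \<open>rate\<close> is nearly minimal
  bounds \<open>q\<close> from below through \<open>rate_comparison\<close>, and the points of the
  radius, being admissible in the infimum, bound it from above.\<close>

lemma radial_limit: "(q \<longlongrightarrow> \<beta>) (at_left 1)"
proof (rule order_tendstoI)
  have ev: "\<forall>\<^sub>F r in at_left (1::real). r \<in> {0<..<1}" by (rule eventually_at_left_real) simp
  fix l assume l: "l < \<beta>"
  \<comment> \<open>Half of the gap is spent on the choice of \<open>z\<close>; the other half
    absorbs the factor \<open>(1 + r) / (2 * r)\<close>, which tends to 1.\<close>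
  define e where "e = (\<beta> - l) / 2"
  have e: "0 < e" "l < \<beta> - e" using l by (auto simp: e_def field_simps)
  have "(INF z\<in>ball 0 1. rate z) < - \<beta> + e" using e(1) by (simp add: dilation_eq)
  then obtain z where z: "norm z < 1" "rate z < - \<beta> + e"
    by (subst (asm) cINF_less_iff [OF _ rate_bdd_below]) auto
  obtain B where B: "(B \<longlongrightarrow> rate z) (at_left 1)" "\<forall>\<^sub>F r in at_left 1. - 2 * r * q r / (1 + r) \<le> B r"
    by (rule rate_comparison [OF z(1)])
  have "\<forall>\<^sub>F r in at_left 1. B r < - \<beta> + e" using order_tendstoD(2) [OF B(1) z(2)] .
  moreover have "((\<lambda>r. (\<beta> - e) * (1 + r) / (2 * r)) \<longlongrightarrow> (\<beta> - e) * (1 + 1) / (2 * 1)) (at_left (1::real))"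
    by (intro tendsto_intros) auto
  then have "\<forall>\<^sub>F r in at_left 1. l < (\<beta> - e) * (1 + r) / (2 * r)"
    by (rule order_tendstoD(1)) (use e in simp)
  ultimately show "\<forall>\<^sub>F r in at_left 1. l < q r"
    using B(2) ev
  proof eventually_elim
    case (elim r)
    then have r: "0 < r" "r < 1" by auto
    have "\<beta> - e < 2 * r * q r / (1 + r)" using elim by simp
    then have "(\<beta> - e) * (1 + r) / (2 * r) < q r" using r by (simp add: field_simps)
    then show ?case using elim by linarith
  qed
next
  have ev: "\<forall>\<^sub>F r in at_left (1::real). r \<in> {0<..<1}" by (rule eventually_at_left_real) simp
  fix u assume u: "\<beta> < u"
  have "((\<lambda>r. \<beta> * (1 + r) / 2) \<longlongrightarrow> \<beta> * (1 + 1) / 2) (at_left (1::real))"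
    by (intro tendsto_intros) auto
  then have "\<forall>\<^sub>F r in at_left 1. \<beta> * (1 + r) / 2 < u"
    by (rule order_tendstoD(2)) (use u in simp)
  then show "\<forall>\<^sub>F r in at_left 1. q r < u"
    using ev
  proof eventually_elim
    case (elim r)
    then have r: "0 < r" "r < 1" by auto
    have "- \<beta> \<le> - 2 * q r / (1 + r)"
      using rate_ge [of "of_real r *s cbasis a"] rate_radius [OF r] r by simp
    then have "q r \<le> \<beta> * (1 + r) / 2" using r by (simp add: field_simps)
    then show ?case using elim by linarith
  qed
qed

lemma slice_limit:
  assumes M: "0 \<le> M" and "0 < \<epsilon>"
  obtains \<delta> where "0 < \<delta>"
    "\<And>w. cmod w < 1 \<Longrightarrow> cmod (1 - w) < \<delta> \<Longrightarrow> cmod (1 - w) \<le> M * (1 - cmod w) \<Longrightarrow> cmod (slice w / (w - 1) - of_real \<beta>) < \<epsilon>"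
proof -
  \<comment> \<open>The first two terms have nonnegative real part since
    \<open>- \<beta> \<le> rate\<close>, and the second cancels the radial limit of the first after
    multiplication by \<open>1 - r\<close>. The summand 1 makes positivity strict and contributes
    only \<open>1 - w\<close> to the product \<open>(1 - w) * P w\<close>.\<close>
  define P where "P \<zeta> = slice \<zeta> / (1 - \<zeta>)\<^sup>2 + of_real (\<beta> / 2) * ((1 + \<zeta>) / (1 - \<zeta>)) + 1" for \<zeta>
  have "slice field_differentiable (at \<zeta>)" if "cmod \<zeta> < 1" for \<zeta>
    using slice_has_field_derivative [OF hol, of 0 \<zeta> "cbasis a" a] that
    unfolding slice_def field_differentiable_def by auto
  then have "slice holomorphic_on ball 0 1"
    unfolding holomorphic_on_def using field_differentiable_at_within by (metis mem_ball_0)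
  then have holP: "P holomorphic_on ball 0 1"
    unfolding P_def by (intro holomorphic_intros) auto
  have pos: "0 < Re (P \<zeta>)" if \<zeta>: "cmod \<zeta> < 1" for \<zeta>
  proof -
    define N D where "N = 1 - (cmod \<zeta>)\<^sup>2" and "D = (cmod (1 - \<zeta>))\<^sup>2"
    have N: "0 < N" using \<zeta> by (simp add: N_def abs_square_less_1)
    have D: "0 < D" using \<zeta> by (auto simp: D_def)
    have "Re ((1 + \<zeta>) / (1 - \<zeta>)) = N / D"
      unfolding Re_divide N_def D_def cmod_power2 by (simp add: power2_eq_square algebra_simps)
    then have ReP: "Re (P \<zeta>) = Re (slice \<zeta> / (1 - \<zeta>)\<^sup>2) + \<beta> / 2 * (N / D) + 1"
      unfolding P_def plus_complex.sel times_complex.sel(1)[of "complex_of_real _"] Re_complex_of_real Im_complex_of_real by simp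
    have "- \<beta> \<le> 2 * D / N * Re (slice \<zeta> / (1 - \<zeta>)\<^sup>2)"
      using rate_ge [of "\<zeta> *s cbasis a"] slice_rate [OF \<zeta>] \<zeta> unfolding N_def D_def by simp
    then have "- \<beta> * (N / D) \<le> 2 * D / N * Re (slice \<zeta> / (1 - \<zeta>)\<^sup>2) * (N / D)"
      using N D by (intro mult_right_mono) auto
    also have "\<dots> = 2 * Re (slice \<zeta> / (1 - \<zeta>)\<^sup>2)" using N D by simp
    finally show ?thesis unfolding ReP by simp
  qed
  have rad: "((\<lambda>r. (1 - r) * Re (P (of_real r))) \<longlongrightarrow> 0) (at_left 1)"
  proof -
    have "((\<lambda>r. - q r + \<beta> / 2 * (1 + r) + (1 - r)) \<longlongrightarrow> - \<beta> + \<beta> / 2 * (1 + 1) + (1 - 1)) (at_left 1)"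
      by (intro tendsto_intros radial_limit)
    then have lim: "((\<lambda>r. - q r + \<beta> / 2 * (1 + r) + (1 - r)) \<longlongrightarrow> 0) (at_left 1)" by simp
    have ev: "\<forall>\<^sub>F r in at_left (1::real). r \<in> {0<..<1}" by (rule eventually_at_left_real) simp
    have "\<forall>\<^sub>F r in at_left 1. - q r + \<beta> / 2 * (1 + r) + (1 - r) = (1 - r) * Re (P (of_real r))"
      using ev
    proof eventually_elim
      case (elim r)
      then have r: "0 < r" "r < 1" by auto
      have "P (of_real r) = slice (of_real r) / of_real ((1 - r)\<^sup>2) + of_real (\<beta> / 2 * ((1 + r) / (1 - r)) + 1)"
        by (simp add: P_def)
      then have "Re (P (of_real r)) = Re (slice (of_real r)) / (1 - r)\<^sup>2 + (\<beta> / 2 * ((1 + r) / (1 - r)) + 1)"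
        by (simp only: plus_complex.sel Re_divide_of_real Re_complex_of_real)
      moreover have "(1 - r) * (Re (slice (of_real r)) / (1 - r)\<^sup>2) = - q r"
        using r minus_divide_right [of "Re (slice (of_real r))" "r - 1"] by (simp add: q_def power2_eq_square)
      moreover have "(1 - r) * (\<beta> / 2 * ((1 + r) / (1 - r))) = \<beta> / 2 * (1 + r)"
      proof -
        have cancel: "d * (b * (c / d)) = b * c" if "d \<noteq> 0" for b c d :: real using that by simp
        show ?thesis by (rule cancel) (use r in simp)
      qed
      ultimately show ?case by (simp only: distrib_left mult_1_right add.assoc)
    qed
    then show ?thesis by (rule Lim_transform_eventually [OF lim])
  qed
  obtain \<delta> where \<delta>: "0 < \<delta>"
    "\<And>w. cmod w < 1 \<Longrightarrow> cmod (1 - w) < \<delta> \<Longrightarrow> cmod (1 - w) \<le> M * (1 - cmod w) \<Longrightarrow> cmod ((1 - w) * P w) < \<epsilon> / 2"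
    by (rule nontangential_limit_from_radial [OF holP pos rad M, of "\<epsilon> / 2"]) (use \<open>0 < \<epsilon>\<close> in auto)
  \<comment> \<open>\<open>1 - \<beta> / 2\<close> is the coefficient of \<open>1 - w\<close> that
    remains when the quotient is expressed by \<open>(1 - w) * P w\<close>; the added 1 keeps
    \<open>K\<close> positive when \<open>\<beta> = 2\<close>.\<close>
  define K where "K = \<bar>1 - \<beta> / 2\<bar> + 1"
  have K: "0 < K" by (simp add: K_def)
  show ?thesis
  proof
    show "0 < min \<delta> (\<epsilon> / (2 * K))" using \<delta>(1) K \<open>0 < \<epsilon>\<close> by simp
    fix w assume w: "cmod w < 1" "cmod (1 - w) < min \<delta> (\<epsilon> / (2 * K))" "cmod (1 - w) \<le> M * (1 - cmod w)"
    have nz: "1 - w \<noteq> 0" using w(1) by auto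
    have "(1 - w) * (slice w / (1 - w)\<^sup>2) = - (slice w / (w - 1))"
      using nz by (simp add: power2_eq_square divide_simps) (simp add: algebra_simps)
    moreover have "(1 - w) * (of_real (\<beta> / 2) * ((1 + w) / (1 - w))) = of_real (\<beta> / 2) * (1 + w)"
    proof -
      have cancel: "d * (b * (c / d)) = b * c" if "d \<noteq> 0" for b c d :: complex using that by simp
      show ?thesis by (rule cancel [OF nz])
    qed
    ultimately have "(1 - w) * P w = - (slice w / (w - 1)) + of_real (\<beta> / 2) * (1 + w) + (1 - w)"
      unfolding P_def distrib_left by simp
    then have "slice w / (w - 1) - of_real \<beta> = - ((1 - w) * P w) + of_real (1 - \<beta> / 2) * (1 - w)"
      by (simp add: field_simps)
    then have "cmod (slice w / (w - 1) - of_real \<beta>) \<le> cmod ((1 - w) * P w) + \<bar>1 - \<beta> / 2\<bar> * cmod (1 - w)"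
      using norm_triangle_ineq [of "- ((1 - w) * P w)" "of_real (1 - \<beta> / 2) * (1 - w)"]
      by (simp only: norm_minus_cancel norm_mult norm_of_real)
    also have "\<dots> < \<epsilon> / 2 + \<epsilon> / 2"
    proof (rule add_less_le_mono)
      show "cmod ((1 - w) * P w) < \<epsilon> / 2" using w by (intro \<delta>(2)) auto
      have "\<bar>1 - \<beta> / 2\<bar> * cmod (1 - w) \<le> K * (\<epsilon> / (2 * K))"
        using w(2) K by (intro mult_mono) (auto simp: K_def)
      then show "\<bar>1 - \<beta> / 2\<bar> * cmod (1 - w) \<le> \<epsilon> / 2" using K by simp
    qed
    finally show "cmod (slice w / (w - 1) - of_real \<beta>) < \<epsilon>" by simp
  qed
qed

end

section \<open>Koranyi regions and restricted limits\<close>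

definition tangential_part :: "'n::finite \<Rightarrow> complex ^ 'n \<Rightarrow> complex ^ 'n" where
  "tangential_part a z = z - z $ a *s cbasis a"

lemma tangential_part_nth: "tangential_part a z $ j = (if j = a then 0 else z $ j)"
  by (simp add: tangential_part_def)

lemma tangential_part_add: "tangential_part a (z + w) = tangential_part a z + tangential_part a w"
  by (simp add: vec_eq_iff tangential_part_nth)

lemma norm_sq_split: "(norm z)\<^sup>2 = (cmod (z $ a))\<^sup>2 + (norm (tangential_part a z))\<^sup>2"
proof -
  have sq: "(norm x)\<^sup>2 = (\<Sum>j\<in>UNIV. (cmod (x $ j))\<^sup>2)" for x :: "complex ^ 'n::finite"
    by (simp add: norm_vec_def L2_set_def sum_nonneg)
  show ?thesis
    unfolding sq sum.remove [OF finite UNIV_I [of a]]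
    by (simp add: tangential_part_nth)
qed

lemma koranyiD:
  assumes "z \<in> koranyi a R"
  shows "norm z < 1" "cmod (1 - z $ a) \<le> R / 2 * (1 - (norm z)\<^sup>2)" "0 < cmod (1 - z $ a)"
  using assms one_minus_nth_nonzero [of z a] by (auto simp: koranyi_def)

lemma one_minus_norm_sq_le: "1 - (cmod w)\<^sup>2 \<le> 2 * cmod (1 - w)" if "cmod w \<le> 1"
proof -
  have "1 - (cmod w)\<^sup>2 = (1 - cmod w) * (1 + cmod w)" by (simp add: power2_eq_square algebra_simps)
  also have "\<dots> \<le> cmod (1 - w) * 2"
    using that norm_triangle_ineq2 [of 1 w] by (intro mult_mono) auto
  finally show ?thesis by simp
qed

text \<open>Put \<open>D = cmod (1 - z $ a)\<close>. The tangential part of \<open>z\<close> is at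
  most of order \<open>sqrt D\<close>, so a tangential displacement of order \<open>sqrt D\<close>
  changes the squared norm only by order \<open>D\<close>, just as a normal displacement of order
  \<open>D\<close> does.\<close>

lemma koranyi_perturb:
  fixes z w :: "complex ^ 'n::finite"
  assumes z: "z \<in> koranyi a R" and R: "1 \<le> R"
    and wa: "cmod (w $ a) \<le> cmod (1 - z $ a) / (8 * R)"
    and wt: "norm (tangential_part a w) \<le> sqrt (cmod (1 - z $ a)) / (8 * R)"
  shows "z + w \<in> koranyi a (4 * R)" "cmod (1 - z $ a) / R \<le> 1 - (norm (z + w))\<^sup>2"
    "cmod (1 - (z + w) $ a) \<le> 2 * cmod (1 - z $ a)"
proof -
  define D where "D = cmod (1 - z $ a)"
  \<comment> \<open>The squared norm grows by at most \<open>8 * (c * D) = D / R\<close>, half of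
    the available \<open>2 * D / R\<close>. Together with the doubled distance to 1, this turns the
    aperture \<open>R\<close> into \<open>4 * R\<close>.\<close>
  define c where "c = 1 / (8 * R)"
  have c: "0 < c" "c \<le> 1 / 8" "8 * c = 1 / R" using R by (auto simp: c_def divide_simps)
  note zD = koranyiD [OF z]
  have D0: "0 < D" using zD(3) by (simp add: D_def)
  have za: "cmod (z $ a) < 1" using norm_nth_less_one [OF zD(1)] .
  have D2: "D \<le> 2" unfolding D_def using norm_triangle_ineq4 [of 1 "z $ a"] za by simp
  have wa': "cmod (w $ a) \<le> c * D" using wa by (simp add: c_def D_def)
  have wt': "norm (tangential_part a w) \<le> c * sqrt D" using wt by (simp add: c_def D_def)
  have ccD: "c * D * (c * D) \<le> c * D / 4" "c * D * c \<le> c * D / 8"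
  proof -
    have "c * D \<le> 1 / 8 * 2" using c D0 D2 by (intro mult_mono) auto
    then have "c * D * (c * D) \<le> c * D * (1 / 4)" using c D0 by (intro mult_left_mono) auto
    then show "c * D * (c * D) \<le> c * D / 4" by simp
    have "c * D * c \<le> c * D * (1 / 8)" using c D0 by (intro mult_left_mono) auto
    then show "c * D * c \<le> c * D / 8" by simp
  qed
  have "cmod ((z + w) $ a) \<le> cmod (z $ a) + c * D"
    using norm_triangle_ineq [of "z $ a" "w $ a"] wa' by simp
  then have "(cmod ((z + w) $ a))\<^sup>2 \<le> (cmod (z $ a) + c * D)\<^sup>2" by (rule power_mono) simp
  also have "\<dots> = (cmod (z $ a))\<^sup>2 + 2 * (c * D) * cmod (z $ a) + c * D * (c * D)"
    by (simp add: power2_eq_square algebra_simps)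
  also have "\<dots> \<le> (cmod (z $ a))\<^sup>2 + 2 * (c * D) * 1 + c * D / 4"
    using za c D0 ccD(1) by (intro add_mono mult_left_mono) auto
  finally have n1: "(cmod ((z + w) $ a))\<^sup>2 \<le> (cmod (z $ a))\<^sup>2 + 9 / 4 * (c * D)" by linarith
  define T where "T = norm (tangential_part a z)"
  have "T\<^sup>2 < 1 - (cmod (z $ a))\<^sup>2"
    using norm_sq_split [of z a] zD(1) abs_square_less_1 [of "norm z"] by (simp add: T_def)
  also have "\<dots> \<le> 2 * D" unfolding D_def using za by (intro one_minus_norm_sq_le) simp
  \<comment> \<open>\<open>3 / 2\<close> is a rational upper bound for
    \<open>sqrt 2\<close>.\<close>
  finally have "T\<^sup>2 \<le> (3 / 2 * sqrt D)\<^sup>2" using D0 by (simp add: power_mult_distrib power2_eq_square)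
  then have T: "T \<le> 3 / 2 * sqrt D" by (rule power2_le_imp_le) (use D0 in auto)
  have "norm (tangential_part a (z + w)) \<le> T + c * sqrt D"
    using norm_triangle_ineq [of "tangential_part a z" "tangential_part a w"] wt' by (simp add: tangential_part_add T_def)
  then have "(norm (tangential_part a (z + w)))\<^sup>2 \<le> (T + c * sqrt D)\<^sup>2" by (rule power_mono) simp
  also have "\<dots> = T\<^sup>2 + 2 * (c * sqrt D) * T + c * D * c"
    using D0 by (simp add: power2_eq_square algebra_simps)
  also have "\<dots> \<le> T\<^sup>2 + 2 * (c * sqrt D) * (3 / 2 * sqrt D) + c * D / 8"
    using T c D0 ccD(2) by (intro add_mono mult_left_mono) auto
  also have "2 * (c * sqrt D) * (3 / 2 * sqrt D) = 3 * (c * D)" using D0 by simp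
  finally have n2: "(norm (tangential_part a (z + w)))\<^sup>2 \<le> T\<^sup>2 + 25 / 8 * (c * D)" by linarith
  have "(norm (z + w))\<^sup>2 \<le> (norm z)\<^sup>2 + 8 * (c * D)"
    using n1 n2 norm_sq_split [of "z + w" a] norm_sq_split [of z a] mult_pos_pos [OF c(1) D0]
    unfolding T_def by linarith
  also have "8 * (c * D) = D / R" using c(3) by (simp add: mult.assoc [symmetric])
  finally have up: "(norm (z + w))\<^sup>2 \<le> (norm z)\<^sup>2 + D / R" .
  have "2 * D / R \<le> 1 - (norm z)\<^sup>2" using zD(2) R by (simp add: D_def field_simps)
  then have low: "D / R \<le> 1 - (norm (z + w))\<^sup>2" using up by simp
  then show "cmod (1 - z $ a) / R \<le> 1 - (norm (z + w))\<^sup>2" by (simp add: D_def)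
  have "c * D \<le> 1 * D" using c D0 by (intro mult_right_mono) auto
  then have up2: "cmod (1 - (z + w) $ a) \<le> 2 * D"
    using norm_triangle_ineq4 [of "1 - z $ a" "w $ a"] wa' by (simp add: D_def algebra_simps)
  then show "cmod (1 - (z + w) $ a) \<le> 2 * cmod (1 - z $ a)" by (simp add: D_def)
  have "D \<le> R * (1 - (norm (z + w))\<^sup>2)" using low R by (simp add: field_simps)
  then have "cmod (1 - (z + w) $ a) \<le> 4 * R / 2 * (1 - (norm (z + w))\<^sup>2)" using up2 by simp
  moreover have "0 < D / R" using D0 R by simp
  then have "(norm (z + w))\<^sup>2 < 1" using low by simp
  then have "norm (z + w) < 1" by (simp add: abs_square_less_1)
  ultimately show "z + w \<in> koranyi a (4 * R)" by (simp add: koranyi_def)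
qed

text \<open>A neighbourhood form of restricted convergence: \<open>M\<close> is the aperture, while
  \<open>\<delta>\<close> bounds both the distance of \<open>z $ a\<close> from 1 and the ratio that
  has to tend to 0. Limits become uniform estimates on these sets, to which Cauchy estimates
  apply.\<close>

definition approach :: "'n::finite \<Rightarrow> real \<Rightarrow> real \<Rightarrow> (complex ^ 'n) set" where
  "approach a M \<delta> = {z \<in> ball 0 1. cmod (1 - z $ a) < \<delta> \<and>
     (norm (tangential_part a z))\<^sup>2 \<le> \<delta> * (1 - (cmod (z $ a))\<^sup>2) \<and> cmod (1 - z $ a) \<le> M * (1 - cmod (z $ a))}"

lemma restricted_K_limitI:
  assumes "\<And>M \<epsilon>. 1 \<le> M \<Longrightarrow> 0 < \<epsilon> \<Longrightarrow> \<exists>\<delta>>0. \<forall>z\<in>approach a M \<delta>. cmod (f z - L) < \<epsilon>"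
  shows "restricted_K_limit a f L"
  unfolding restricted_K_limit_def cinner_cbasis
proof (intro allI impI, elim conjE)
  fix zs :: "nat \<Rightarrow> complex ^ 'a"
  assume inb: "\<forall>k. zs k \<in> ball 0 1"
    and special: "(\<lambda>k. (norm (zs k - zs k $ a *s cbasis a))\<^sup>2 / (1 - (cmod (zs k $ a))\<^sup>2)) \<longlonglongrightarrow> 0"
    and nt: "nontangential_to_one (\<lambda>k. zs k $ a)"
  obtain M where M: "\<And>k. cmod (1 - zs k $ a) \<le> M * (1 - cmod (zs k $ a))"
    using nt by (auto simp: nontangential_to_one_def)
  have lim1: "(\<lambda>k. zs k $ a) \<longlonglongrightarrow> 1" using nt by (simp add: nontangential_to_one_def)
  show "(\<lambda>k. f (zs k)) \<longlonglongrightarrow> L"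
  proof (rule tendstoI)
    fix \<epsilon> :: real assume "0 < \<epsilon>"
    obtain \<delta> where \<delta>: "0 < \<delta>" "\<And>z. z \<in> approach a (max M 1) \<delta> \<Longrightarrow> cmod (f z - L) < \<epsilon>"
      using assms [of "max M 1" \<epsilon>] \<open>0 < \<epsilon>\<close> by auto
    have "\<forall>\<^sub>F k in sequentially. cmod (1 - zs k $ a) < \<delta>"
      using tendstoD [OF lim1 \<delta>(1)] by (simp add: dist_norm norm_minus_commute)
    moreover have "\<forall>\<^sub>F k in sequentially. (norm (zs k - zs k $ a *s cbasis a))\<^sup>2 / (1 - (cmod (zs k $ a))\<^sup>2) < \<delta>"
      using order_tendstoD(2) [OF special \<delta>(1)] .
    ultimately show "\<forall>\<^sub>F k in sequentially. dist (f (zs k)) L < \<epsilon>"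
    proof eventually_elim
      case (elim k)
      have za: "cmod (zs k $ a) < 1" using inb by (intro norm_nth_less_one) simp
      then have "0 < 1 - (cmod (zs k $ a))\<^sup>2" by (simp add: abs_square_less_1)
      then have "(norm (tangential_part a (zs k)))\<^sup>2 \<le> \<delta> * (1 - (cmod (zs k $ a))\<^sup>2)"
        using elim(2) by (simp add: tangential_part_def pos_divide_less_eq)
      moreover have "M * (1 - cmod (zs k $ a)) \<le> max M 1 * (1 - cmod (zs k $ a))"
        using za by (intro mult_right_mono) auto
      then have "cmod (1 - zs k $ a) \<le> max M 1 * (1 - cmod (zs k $ a))"
        using M [of k] by linarith
      ultimately have "zs k \<in> approach a (max M 1) \<delta>"
        using elim(1) inb unfolding approach_def by auto
      then show ?case using \<delta>(2) by (simp add: dist_norm)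
    qed
  qed
qed

text \<open>With \<open>\<delta> \<le> 1 / 2\<close> the tangential part uses up at most half of
  \<open>1 - (cmod (z $ a))\<^sup>2\<close>, so the aperture of the slice passes to the ball at the
  cost of a constant.\<close>

lemma approach_subset_koranyi:
  assumes z: "z \<in> approach a M \<delta>" and "\<delta> \<le> 1 / 2" "1 \<le> M"
  shows "z \<in> koranyi a (4 * M)"
proof -
  have zb: "norm z < 1" and t: "(norm (tangential_part a z))\<^sup>2 \<le> \<delta> * (1 - (cmod (z $ a))\<^sup>2)"
    and nt: "cmod (1 - z $ a) \<le> M * (1 - cmod (z $ a))"
    using z by (auto simp: approach_def)
  have za: "cmod (z $ a) < 1" using norm_nth_less_one [OF zb] .
  then have "0 < 1 - (cmod (z $ a))\<^sup>2" by (simp add: abs_square_less_1)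
  then have "\<delta> * (1 - (cmod (z $ a))\<^sup>2) \<le> 1 / 2 * (1 - (cmod (z $ a))\<^sup>2)"
    using assms(2) by (intro mult_right_mono) auto
  then have "1 / 2 * (1 - (cmod (z $ a))\<^sup>2) \<le> 1 - (norm z)\<^sup>2"
    using t norm_sq_split [of z a] by simp
  moreover have "1 - cmod (z $ a) \<le> 1 - (cmod (z $ a))\<^sup>2"
    using za by (simp add: power2_eq_square mult_left_le)
  ultimately have "1 - cmod (z $ a) \<le> 2 * (1 - (norm z)\<^sup>2)" by simp
  then have "M * (1 - cmod (z $ a)) \<le> M * (2 * (1 - (norm z)\<^sup>2))"
    using assms(3) by (intro mult_left_mono) auto
  also have "\<dots> = 4 * M / 2 * (1 - (norm z)\<^sup>2)" by simp
  finally show ?thesis using nt zb unfolding koranyi_def by simp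
qed

section \<open>Cauchy estimates and transfer from the slice\<close>

context koranyi_generator
begin

text \<open>The disc in the normal direction has the largest radius that
  \<open>koranyi_perturb\<close> allows there. The hypothesis on \<open>B\<close> is restricted to
  points at most twice as far from 1, since only these occur on the disc.\<close>

lemma dG_normal_dir:
  assumes R: "1 \<le> R" and z: "z \<in> koranyi a R"
    and bd: "\<And>y. y \<in> koranyi a (4 * R) \<Longrightarrow> cmod (1 - y $ a) \<le> 2 * cmod (1 - z $ a) \<Longrightarrow> cmod (G y $ k) \<le> B"
  shows "cmod (dG G z (cbasis a) $ k) \<le> 8 * R * B / cmod (1 - z $ a)"
proof -
  define r where "r = cmod (1 - z $ a) / (8 * R)"
  have r: "0 < r" using koranyiD(3) [OF z] R by (simp add: r_def)
  have p: "z + \<zeta> *s cbasis a \<in> koranyi a (4 * R)" "cmod (1 - (z + \<zeta> *s cbasis a) $ a) \<le> 2 * cmod (1 - z $ a)"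
    if "cmod \<zeta> \<le> r" for \<zeta>
  proof -
    have "tangential_part a (\<zeta> *s cbasis a) = 0" by (simp add: vec_eq_iff tangential_part_nth)
    then show "z + \<zeta> *s cbasis a \<in> koranyi a (4 * R)" "cmod (1 - (z + \<zeta> *s cbasis a) $ a) \<le> 2 * cmod (1 - z $ a)"
      using koranyi_perturb(1,3) [OF z R, of "\<zeta> *s cbasis a"] that R by (simp_all add: r_def)
  qed
  have "cmod (dG G z (cbasis a) $ k - 0) \<le> B / r"
    by (rule directional_Cauchy_estimate [OF hol r, where c\<^sub>0 = 0]) (use p bd in \<open>auto simp: koranyi_def\<close>)
  then show ?thesis by (simp add: r_def mult_ac)
qed

lemma dG_tangential_dir:
  assumes R: "1 \<le> R" and z: "z \<in> koranyi a R" and v: "v $ a = 0"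
    and bd: "\<And>y. y \<in> koranyi a (4 * R) \<Longrightarrow> cmod (1 - y $ a) \<le> 2 * cmod (1 - z $ a) \<Longrightarrow> cmod (G y $ k) \<le> B"
  shows "cmod (dG G z v $ k) \<le> 8 * R * B / sqrt (cmod (1 - z $ a)) * norm v"
proof (cases "v = 0")
  case True
  then show ?thesis
    using holomorphic_vec_has_derivative(2) [OF hol, of z 0 0] koranyiD(1) [OF z] by simp
next
  case False
  define r where "r = sqrt (cmod (1 - z $ a)) / (8 * R) / norm v"
  have r: "0 < r" using koranyiD(3) [OF z] R False by (simp add: r_def)
  have p: "z + \<zeta> *s v \<in> koranyi a (4 * R)" "cmod (1 - (z + \<zeta> *s v) $ a) \<le> 2 * cmod (1 - z $ a)"
    if "cmod \<zeta> \<le> r" for \<zeta>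
  proof -
    have "tangential_part a (\<zeta> *s v) = \<zeta> *s v" using v by (simp add: vec_eq_iff tangential_part_nth)
    moreover have "norm (\<zeta> *s v) \<le> sqrt (cmod (1 - z $ a)) / (8 * R)"
    proof -
      have "0 < norm v" using False by simp
      then show ?thesis using that unfolding r_def norm_scale_vec by (simp only: pos_le_divide_eq)
    qed
    ultimately show "z + \<zeta> *s v \<in> koranyi a (4 * R)" "cmod (1 - (z + \<zeta> *s v) $ a) \<le> 2 * cmod (1 - z $ a)"
      using koranyi_perturb(1,3) [OF z R, of "\<zeta> *s v"] R v by simp_all
  qed
  have "cmod (dG G z v $ k - 0) \<le> B / r"
    by (rule directional_Cauchy_estimate [OF hol r, where c\<^sub>0 = 0]) (use p bd in \<open>auto simp: koranyi_def\<close>)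
  then show ?thesis by (simp add: r_def mult_ac)
qed

lemma sqrt_double_le: "x \<le> 2 * y \<Longrightarrow> 0 \<le> y \<Longrightarrow> sqrt x \<le> 2 * sqrt y"
  using real_sqrt_le_mono [of x "4 * y"] real_sqrt_mult [of 4 y] by simp

text \<open>Cauchy estimates evaluate \<open>G\<close> at points \<open>y\<close> near
  \<open>z\<close>, while the bound has to be expressed at \<open>z\<close>; the doubled distance
  costs a factor 2.\<close>

lemma normal_bound_double:
  assumes "1 \<le> R"
  obtains M where "0 \<le> M" "\<And>z y. y \<in> koranyi a R \<Longrightarrow> cmod (1 - y $ a) \<le> 2 * cmod (1 - z $ a) \<Longrightarrow>
    cmod (G y $ a) \<le> M * cmod (1 - z $ a)"
proof -
  obtain M where M: "0 \<le> M" "\<And>y. y \<in> koranyi a R \<Longrightarrow> cmod (G y $ a) \<le> M * cmod (1 - y $ a)"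
    using normal_bound [OF assms] by blast
  have "cmod (G y $ a) \<le> 2 * M * cmod (1 - z $ a)"
    if "y \<in> koranyi a R" "cmod (1 - y $ a) \<le> 2 * cmod (1 - z $ a)" for y z
    using M(2) [OF that(1)] mult_left_mono [OF that(2) M(1)] by simp
  then show ?thesis using M(1) by (intro that [of "2 * M"]) auto
qed

lemma tangential_bound_double:
  assumes "1 \<le> R" "j \<noteq> a"
  obtains M where "0 \<le> M" "\<And>z y. y \<in> koranyi a R \<Longrightarrow> cmod (1 - y $ a) \<le> 2 * cmod (1 - z $ a) \<Longrightarrow>
    cmod (G y $ j) \<le> M * sqrt (cmod (1 - z $ a))"
proof -
  obtain M where M: "0 \<le> M" "\<And>y. y \<in> koranyi a R \<Longrightarrow> cmod (G y $ j) \<le> M * sqrt (cmod (1 - y $ a))"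
    using tangential_bound [OF assms] by blast
  have "cmod (G y $ j) \<le> 2 * M * sqrt (cmod (1 - z $ a))"
    if "y \<in> koranyi a R" "cmod (1 - y $ a) \<le> 2 * cmod (1 - z $ a)" for y z
    using M(2) [OF that(1)] mult_left_mono [OF sqrt_double_le [OF that(2)] M(1)] by simp
  then show ?thesis using M(1) by (intro that [of "2 * M"]) auto
qed

lemma dG_normal_normal: "bounded_on_koranyi a (\<lambda>z. cmod (dG G z (cbasis a) $ a))"
  unfolding bounded_on_koranyi_def
proof (intro allI impI)
  fix R :: real assume R: "1 \<le> R"
  obtain M where M: "0 \<le> M" "\<And>z y. y \<in> koranyi a (4 * R) \<Longrightarrow> cmod (1 - y $ a) \<le> 2 * cmod (1 - z $ a) \<Longrightarrow>
    cmod (G y $ a) \<le> M * cmod (1 - z $ a)"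
    by (rule normal_bound_double [of "4 * R"]) (use R in auto)
  have "cmod (dG G z (cbasis a) $ a) \<le> 8 * R * M" if z: "z \<in> koranyi a R" for z
    using dG_normal_dir [OF R z M(2) [where z = z]] koranyiD(3) [OF z] by simp
  then show "\<exists>M. \<forall>z\<in>koranyi a R. \<bar>cmod (dG G z (cbasis a) $ a)\<bar> \<le> M" by auto
qed

lemma dG_tangential_tangential:
  assumes "h \<noteq> a" "k \<noteq> a"
  shows "bounded_on_koranyi a (\<lambda>z. cmod (dG G z (cbasis h) $ k))"
  unfolding bounded_on_koranyi_def
proof (intro allI impI)
  fix R :: real assume R: "1 \<le> R"
  obtain M where M: "0 \<le> M" "\<And>z y. y \<in> koranyi a (4 * R) \<Longrightarrow> cmod (1 - y $ a) \<le> 2 * cmod (1 - z $ a) \<Longrightarrow>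
    cmod (G y $ k) \<le> M * sqrt (cmod (1 - z $ a))"
    by (rule tangential_bound_double [of "4 * R" k]) (use R assms in auto)
  have "cmod (dG G z (cbasis h) $ k) \<le> 8 * R * M" if z: "z \<in> koranyi a R" for z
    using dG_tangential_dir [OF R z _ M(2) [where z = z], of "cbasis h"] koranyiD(3) [OF z] assms by simp
  then show "\<exists>M. \<forall>z\<in>koranyi a R. \<bar>cmod (dG G z (cbasis h) $ k)\<bar> \<le> M" by auto
qed

text \<open>A component of order \<open>D = cmod (1 - z $ a)\<close> over a radius of order
  \<open>sqrt D\<close> leaves \<open>sqrt D\<close>. This decay yields both the transfer from the
  slice and the vanishing limit of the mixed derivative.\<close>

lemma dG_tangential_normal:
  assumes R: "1 \<le> R"
  obtains C where "0 \<le> C" "\<And>z v. z \<in> koranyi a R \<Longrightarrow> v $ a = 0 \<Longrightarrow>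
    cmod (dG G z v $ a) \<le> C * sqrt (cmod (1 - z $ a)) * norm v"
proof -
  obtain M where M: "0 \<le> M" "\<And>z y. y \<in> koranyi a (4 * R) \<Longrightarrow> cmod (1 - y $ a) \<le> 2 * cmod (1 - z $ a) \<Longrightarrow>
    cmod (G y $ a) \<le> M * cmod (1 - z $ a)"
    by (rule normal_bound_double [of "4 * R"]) (use R in auto)
  show ?thesis
  proof
    show "0 \<le> 8 * R * M" using R M by simp
    fix z v :: "complex ^ 'n" assume z: "z \<in> koranyi a R" and v: "v $ a = 0"
    have "cmod (dG G z v $ a) \<le> 8 * R * (M * cmod (1 - z $ a)) / sqrt (cmod (1 - z $ a)) * norm v"
      by (rule dG_tangential_dir [OF R z v M(2) [where z = z]])
    also have "\<dots> = 8 * R * M * (cmod (1 - z $ a) / sqrt (cmod (1 - z $ a))) * norm v" by simp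
    also have "cmod (1 - z $ a) / sqrt (cmod (1 - z $ a)) = sqrt (cmod (1 - z $ a))"
      by (rule real_div_sqrt) simp
    finally show "cmod (dG G z v $ a) \<le> 8 * R * M * sqrt (cmod (1 - z $ a)) * norm v" .
  qed
qed

lemma dG_tangential_normal_bounded:
  assumes "j \<noteq> a"
  shows "bounded_on_koranyi a (\<lambda>z. cmod (dG G z (cbasis j) $ a / csqrt (1 - z $ a)))"
  unfolding bounded_on_koranyi_def
proof (intro allI impI)
  fix R :: real assume R: "1 \<le> R"
  obtain C where C: "0 \<le> C" "\<And>z v. z \<in> koranyi a R \<Longrightarrow> v $ a = 0 \<Longrightarrow>
    cmod (dG G z v $ a) \<le> C * sqrt (cmod (1 - z $ a)) * norm v"
    using dG_tangential_normal [OF R] by blast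
  have "cmod (dG G z (cbasis j) $ a / csqrt (1 - z $ a)) \<le> C" if z: "z \<in> koranyi a R" for z
    using C(2) [OF z, of "cbasis j"] koranyiD(3) [OF z] assms
    by (simp add: norm_divide pos_divide_le_eq)
  then show "\<exists>M. \<forall>z\<in>koranyi a R. \<bar>cmod (dG G z (cbasis j) $ a / csqrt (1 - z $ a))\<bar> \<le> M" by auto
qed

text \<open>Here the quotient is inverted: a component of order \<open>sqrt D\<close> over a radius
  of order \<open>D\<close>, a growth which the factor \<open>csqrt (1 - z $ a)\<close>
  compensates.\<close>

lemma dG_normal_tangential_bounded:
  assumes "j \<noteq> a"
  shows "bounded_on_koranyi a (\<lambda>z. cmod (csqrt (1 - z $ a) * dG G z (cbasis a) $ j))"
  unfolding bounded_on_koranyi_def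
proof (intro allI impI)
  fix R :: real assume R: "1 \<le> R"
  obtain M where M: "0 \<le> M" "\<And>z y. y \<in> koranyi a (4 * R) \<Longrightarrow> cmod (1 - y $ a) \<le> 2 * cmod (1 - z $ a) \<Longrightarrow>
    cmod (G y $ j) \<le> M * sqrt (cmod (1 - z $ a))"
    by (rule tangential_bound_double [of "4 * R" j]) (use R assms in auto)
  have "cmod (csqrt (1 - z $ a) * dG G z (cbasis a) $ j) \<le> 8 * R * M" if z: "z \<in> koranyi a R" for z
  proof -
    define s where "s = sqrt (cmod (1 - z $ a))"
    have s: "0 < s" "cmod (1 - z $ a) = s * s" using koranyiD(3) [OF z] by (auto simp: s_def)
    have "cmod (dG G z (cbasis a) $ j) \<le> 8 * R * (M * s) / cmod (1 - z $ a)"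
      unfolding s_def by (rule dG_normal_dir [OF R z M(2) [where z = z]])
    then have "s * cmod (dG G z (cbasis a) $ j) \<le> s * (8 * R * (M * s) / (s * s))"
      using s by (intro mult_left_mono) auto
    also have "\<dots> = 8 * R * M" using s by simp
    finally show ?thesis by (simp add: norm_mult s_def)
  qed
  then show "\<exists>M. \<forall>z\<in>koranyi a R. \<bar>cmod (csqrt (1 - z $ a) * dG G z (cbasis a) $ j)\<bar> \<le> M" by auto
qed

text \<open>Mean value inequality along the segment from the slice to \<open>z\<close>. Scaling the
  tangential part by a factor of modulus at most 1 keeps \<open>z $ a\<close> and does not increase
  the norm, so the path stays in the same region and one \<open>C\<close> applies
  throughout.\<close>

lemma normal_difference:
  assumes R: "1 \<le> R"
  obtains C where "0 \<le> C" "\<And>z. z \<in> koranyi a R \<Longrightarrow>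
    cmod (G z $ a - slice (z $ a)) \<le> C * sqrt (cmod (1 - z $ a)) * norm (tangential_part a z)"
proof -
  obtain C where C: "0 \<le> C" "\<And>z v. z \<in> koranyi a R \<Longrightarrow> v $ a = 0 \<Longrightarrow>
    cmod (dG G z v $ a) \<le> C * sqrt (cmod (1 - z $ a)) * norm v"
    using dG_tangential_normal [OF R] by blast
  show ?thesis
  proof
    show "0 \<le> C" by (rule C)
    fix z :: "complex ^ 'n" assume z: "z \<in> koranyi a R"
    define t where "t = tangential_part a z"
    define p where "p \<zeta> = z $ a *s cbasis a + \<zeta> *s t" for \<zeta>
    have pa: "p \<zeta> $ a = z $ a" for \<zeta> by (simp add: p_def t_def tangential_part_nth)
    have ta: "t $ a = 0" by (simp add: t_def tangential_part_nth)
    have p: "p \<zeta> \<in> koranyi a R" if "cmod \<zeta> \<le> 1" for \<zeta>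
    proof -
      have "tangential_part a (p \<zeta>) = \<zeta> *s t" by (auto simp: vec_eq_iff tangential_part_nth p_def ta)
      then have "(norm (p \<zeta>))\<^sup>2 = (cmod (z $ a))\<^sup>2 + (cmod \<zeta> * norm t)\<^sup>2"
        using norm_sq_split [of "p \<zeta>" a] by (simp add: pa norm_scale_vec)
      also have "\<dots> \<le> (cmod (z $ a))\<^sup>2 + (norm t)\<^sup>2"
        using that by (intro add_left_mono power_mono) (auto simp: mult_left_le_one_le)
      also have "\<dots> = (norm z)\<^sup>2" using norm_sq_split [of z a] by (simp add: t_def)
      finally have le: "(norm (p \<zeta>))\<^sup>2 \<le> (norm z)\<^sup>2" .
      then have "norm (p \<zeta>) < 1" using koranyiD(1) [OF z] by (meson le_less_trans norm_ge_zero power2_le_imp_le)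
      moreover have "R / 2 * (1 - (norm z)\<^sup>2) \<le> R / 2 * (1 - (norm (p \<zeta>))\<^sup>2)"
        using le R by (intro mult_left_mono) auto
      ultimately show ?thesis using koranyiD(2) [OF z] by (simp add: koranyi_def pa)
    qed
    have "cmod (G (p 1) $ a - G (p 0) $ a) \<le> C * sqrt (cmod (1 - z $ a)) * norm t * cmod (1 - 0)"
    proof (rule field_differentiable_bound [of "cball 0 1" "\<lambda>\<zeta>. G (p \<zeta>) $ a" "\<lambda>\<zeta>. dG G (p \<zeta>) t $ a"])
      fix \<zeta> :: complex assume "\<zeta> \<in> cball 0 1"
      then have k: "p \<zeta> \<in> koranyi a R" by (intro p) simp
      then have "p \<zeta> \<in> ball 0 1" by (simp add: koranyi_def)
      then show "((\<lambda>\<zeta>. G (p \<zeta>) $ a) has_field_derivative dG G (p \<zeta>) t $ a) (at \<zeta> within cball 0 1)"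
        unfolding p_def by (rule has_field_derivative_at_within [OF slice_has_field_derivative [OF hol]])
      show "cmod (dG G (p \<zeta>) t $ a) \<le> C * sqrt (cmod (1 - z $ a)) * norm t"
        using C(2) [OF k ta] by (simp add: pa)
    qed auto
    moreover have "p 1 = z" by (simp add: p_def t_def tangential_part_def)
    moreover have "G (p 0) $ a = slice (z $ a)" by (simp add: p_def slice_def)
    ultimately show "cmod (G z $ a - slice (z $ a)) \<le> C * sqrt (cmod (1 - z $ a)) * norm (tangential_part a z)"
      by (simp add: t_def)
  qed
qed

text \<open>Divided by the distance \<open>D\<close> of \<open>z $ a\<close> from 1, the deviation
  from the slice is at most a multiple of \<open>norm (tangential_part a z) / sqrt D\<close>, which
  is exactly what restricted convergence makes small.\<close>

lemma normal_limit:
  assumes M: "1 \<le> M" and \<epsilon>: "0 < \<epsilon>"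
  obtains \<delta> where "0 < \<delta>" "\<And>z. z \<in> approach a M \<delta> \<Longrightarrow> cmod (G z $ a / (z $ a - 1) - of_real \<beta>) < \<epsilon>"
proof -
  obtain \<delta>\<^sub>1 where d1: "0 < \<delta>\<^sub>1"
    "\<And>w. cmod w < 1 \<Longrightarrow> cmod (1 - w) < \<delta>\<^sub>1 \<Longrightarrow> cmod (1 - w) \<le> M * (1 - cmod w) \<Longrightarrow> cmod (slice w / (w - 1) - of_real \<beta>) < \<epsilon> / 2"
    by (rule slice_limit [of M "\<epsilon> / 2"]) (use M \<epsilon> in auto)
  obtain C where C: "0 \<le> C" "\<And>z. z \<in> koranyi a (4 * M) \<Longrightarrow>
    cmod (G z $ a - slice (z $ a)) \<le> C * sqrt (cmod (1 - z $ a)) * norm (tangential_part a z)"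
    by (rule normal_difference [of "4 * M"]) (use M in auto)
  \<comment> \<open>Solved from \<open>\<delta>\<^sub>2 * (2 * D) = (\<epsilon> / (2 * (C + 1)) *
    sqrt D)\<^sup>2\<close>; \<open>C + 1\<close> avoids division by zero.\<close>
  define \<delta>\<^sub>2 where "\<delta>\<^sub>2 = (\<epsilon> / (2 * (C + 1)))\<^sup>2 / 2"
  define \<delta> where "\<delta> = min (1 / 2) (min \<delta>\<^sub>1 \<delta>\<^sub>2)"
  have d2: "0 < \<delta>\<^sub>2" using \<epsilon> C by (simp add: \<delta>\<^sub>2_def)
  show ?thesis
  proof
    show "0 < \<delta>" using d1 d2 by (simp add: \<delta>_def)
    fix z assume z: "z \<in> approach a M \<delta>"
    have zb: "norm z < 1" and t: "(norm (tangential_part a z))\<^sup>2 \<le> \<delta> * (1 - (cmod (z $ a))\<^sup>2)"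
      and nt: "cmod (1 - z $ a) \<le> M * (1 - cmod (z $ a))" and cl: "cmod (1 - z $ a) < \<delta>"
      using z by (auto simp: approach_def)
    have k: "z \<in> koranyi a (4 * M)" using approach_subset_koranyi [OF z _ M] by (simp add: \<delta>_def)
    have za: "cmod (z $ a) < 1" using norm_nth_less_one [OF zb] .
    define D where "D = cmod (1 - z $ a)"
    have D: "0 < D" using koranyiD(3) [OF k] by (simp add: D_def)
    have s: "cmod (slice (z $ a) / (z $ a - 1) - of_real \<beta>) < \<epsilon> / 2"
      using za nt cl by (intro d1(2)) (auto simp: \<delta>_def)
    have "(norm (tangential_part a z))\<^sup>2 \<le> \<delta>\<^sub>2 * (2 * D)"
    proof -
      have "\<delta> * (1 - (cmod (z $ a))\<^sup>2) \<le> \<delta>\<^sub>2 * (2 * D)"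
        using za d2 one_minus_norm_sq_le [of "z $ a"] abs_square_less_1 [of "cmod (z $ a)"]
        by (intro mult_mono) (auto simp: \<delta>_def D_def)
      then show ?thesis using t by linarith
    qed
    also have "\<dots> = (\<epsilon> / (2 * (C + 1)) * sqrt D)\<^sup>2"
      unfolding \<delta>\<^sub>2_def power_mult_distrib using D by simp
    finally have tn: "norm (tangential_part a z) \<le> \<epsilon> / (2 * (C + 1)) * sqrt D"
      by (rule power2_le_imp_le) (use C \<epsilon> D in auto)
    have "cmod (G z $ a - slice (z $ a)) \<le> C * sqrt D * norm (tangential_part a z)"
      using C(2) [OF k] by (simp add: D_def)
    also have "\<dots> \<le> C * sqrt D * (\<epsilon> / (2 * (C + 1)) * sqrt D)"
      using C D tn by (intro mult_left_mono) auto
    also have "\<dots> = C / (C + 1) * (\<epsilon> / 2) * (sqrt D * sqrt D)" by (simp add: field_simps)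
    also have "sqrt D * sqrt D = D" using D by simp
    also have "C / (C + 1) * (\<epsilon> / 2) * D \<le> 1 * (\<epsilon> / 2) * D" using C \<epsilon> D by (intro mult_right_mono) auto
    finally have "cmod (G z $ a - slice (z $ a)) / D \<le> \<epsilon> / 2" using D by (simp add: pos_divide_le_eq)
    moreover have "cmod ((G z $ a - slice (z $ a)) / (z $ a - 1)) = cmod (G z $ a - slice (z $ a)) / D"
      by (simp add: norm_divide D_def norm_minus_commute)
    moreover have split: "G z $ a / (z $ a - 1) - of_real \<beta> = (G z $ a - slice (z $ a)) / (z $ a - 1) + (slice (z $ a) / (z $ a - 1) - of_real \<beta>)"
      by (simp add: diff_divide_distrib)
    ultimately show "cmod (G z $ a / (z $ a - 1) - of_real \<beta>) < \<epsilon>"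
      using s norm_triangle_ineq [of "(G z $ a - slice (z $ a)) / (z $ a - 1)" "slice (z $ a) / (z $ a - 1) - of_real \<beta>"]
      unfolding split by linarith
  qed
qed

text \<open>The radius is that of \<open>koranyi_perturb\<close> for \<open>R = 4 * M\<close>. The
  tangential part is unchanged and \<open>1 - (cmod (y $ a))\<^sup>2\<close> is at least
  \<open>D / R\<close>, so the ratio worsens by at most \<open>2 * R = 8 * M\<close> and the
  aperture becomes \<open>4 * R = 16 * M\<close>.\<close>

lemma approach_perturb_normal:
  assumes z: "z \<in> approach a M \<delta>" and M: "1 \<le> M" and "\<delta> \<le> 1 / 2" "\<delta> \<le> \<delta>' / (8 * M)"
    and \<zeta>: "cmod \<zeta> \<le> cmod (1 - z $ a) / (32 * M)"
  shows "z + \<zeta> *s cbasis a \<in> approach a (16 * M) \<delta>'" "cmod (1 - (z + \<zeta> *s cbasis a) $ a) \<le> 2 * cmod (1 - z $ a)"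
proof -
  define R where "R = 4 * M"
  define D where "D = cmod (1 - z $ a)"
  define y where "y = z + \<zeta> *s cbasis a"
  have R: "1 \<le> R" using M by (simp add: R_def)
  have k: "z \<in> koranyi a R" using approach_subset_koranyi [OF z assms(3) M] by (simp add: R_def)
  have zb: "norm z < 1" and t: "(norm (tangential_part a z))\<^sup>2 \<le> \<delta> * (1 - (cmod (z $ a))\<^sup>2)" and cl: "D < \<delta>"
    using z by (auto simp: approach_def D_def)
  have D: "0 < D" using koranyiD(3) [OF k] by (simp add: D_def)
  have za: "cmod (z $ a) < 1" using norm_nth_less_one [OF zb] .
  have t0: "tangential_part a (\<zeta> *s cbasis a) = 0" by (simp add: vec_eq_iff tangential_part_nth)
  have y: "y \<in> koranyi a (4 * R)" "D / R \<le> 1 - (norm y)\<^sup>2" "cmod (1 - y $ a) \<le> 2 * D"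
    unfolding y_def D_def
    by (rule koranyi_perturb [OF k R]; use \<zeta> R t0 in \<open>simp add: R_def\<close>)+
  have ya: "cmod (y $ a) < 1" using norm_nth_less_one [OF koranyiD(1) [OF y(1)]] .
  have "(cmod (y $ a))\<^sup>2 \<le> (norm y)\<^sup>2"
    using Finite_Cartesian_Product.norm_nth_le [of y a] by (intro power_mono) auto
  then have "R * (1 - (norm y)\<^sup>2) \<le> R * (1 - (cmod (y $ a))\<^sup>2)"
    using R by (intro mult_left_mono) auto
  moreover have "D \<le> R * (1 - (norm y)\<^sup>2)" using y(2) R by (simp add: pos_divide_le_eq mult.commute)
  ultimately have yD: "D \<le> R * (1 - (cmod (y $ a))\<^sup>2)" by linarith
  have d0: "0 < \<delta>" using cl D by simp
  have d': "8 * M * \<delta> \<le> \<delta>'" using assms(4) M by (simp add: pos_le_divide_eq mult.commute)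
  have "(norm (tangential_part a y))\<^sup>2 \<le> \<delta> * (2 * D)"
  proof -
    have "\<delta> * (1 - (cmod (z $ a))\<^sup>2) \<le> \<delta> * (2 * D)"
      unfolding D_def using d0 za by (intro mult_left_mono one_minus_norm_sq_le) auto
    then show ?thesis using t by (simp add: y_def tangential_part_add t0)
  qed
  also have "\<dots> \<le> \<delta> * (2 * (R * (1 - (cmod (y $ a))\<^sup>2)))"
    using yD d0 by (intro mult_left_mono) auto
  also have "\<dots> = 8 * M * \<delta> * (1 - (cmod (y $ a))\<^sup>2)" by (simp add: R_def)
  also have "\<dots> \<le> \<delta>' * (1 - (cmod (y $ a))\<^sup>2)"
    using d' ya abs_square_less_1 [of "cmod (y $ a)"] by (intro mult_right_mono) auto
  finally have A: "(norm (tangential_part a y))\<^sup>2 \<le> \<delta>' * (1 - (cmod (y $ a))\<^sup>2)" .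
  have "1 * \<delta> \<le> M * \<delta>" using M d0 by (intro mult_right_mono) auto
  then have B: "cmod (1 - y $ a) < \<delta>'" using y(3) cl d' d0 by linarith
  have "1 - (cmod (y $ a))\<^sup>2 = (1 + cmod (y $ a)) * (1 - cmod (y $ a))" by (simp add: power2_eq_square algebra_simps)
  also have "\<dots> \<le> 2 * (1 - cmod (y $ a))" using ya by (intro mult_right_mono) auto
  finally have "R * (1 - (cmod (y $ a))\<^sup>2) \<le> R * (2 * (1 - cmod (y $ a)))"
    using R by (intro mult_left_mono) auto
  then have "cmod (1 - y $ a) \<le> 2 * (R * (2 * (1 - cmod (y $ a))))" using y(3) yD by linarith
  also have "\<dots> = 16 * M * (1 - cmod (y $ a))" by (simp add: R_def)
  finally have "cmod (1 - y $ a) \<le> 16 * M * (1 - cmod (y $ a))" .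
  then show "z + \<zeta> *s cbasis a \<in> approach a (16 * M) \<delta>'"
    using A B koranyiD(1) [OF y(1)] unfolding y_def [symmetric] approach_def by simp
  show "cmod (1 - (z + \<zeta> *s cbasis a) $ a) \<le> 2 * cmod (1 - z $ a)"
    using y(3) by (simp only: y_def D_def)
qed

lemma dG_normal_limit:
  assumes M: "1 \<le> M" and \<epsilon>: "0 < \<epsilon>"
  shows "\<exists>\<delta>>0. \<forall>z\<in>approach a M \<delta>. cmod (dG G z (cbasis a) $ a - of_real \<beta>) < \<epsilon>"
proof -
  \<comment> \<open>The Cauchy quotient is \<open>e * (2 * D) / (D / (32 * M)) = 64 * M * e\<close>,
    that is \<open>\<epsilon> / 2\<close>.\<close>
  define e where "e = \<epsilon> / (128 * M)"
  obtain \<delta>' where d': "0 < \<delta>'" "\<And>z. z \<in> approach a (16 * M) \<delta>' \<Longrightarrow> cmod (G z $ a / (z $ a - 1) - of_real \<beta>) < e"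
    by (rule normal_limit [of "16 * M" e]) (use M \<epsilon> in \<open>auto simp: e_def\<close>)
  define \<delta> where "\<delta> = min (1 / 2) (\<delta>' / (8 * M))"
  have "cmod (dG G z (cbasis a) $ a - of_real \<beta>) < \<epsilon>" if z: "z \<in> approach a M \<delta>" for z
  proof -
    define D where "D = cmod (1 - z $ a)"
    define r where "r = D / (32 * M)"
    have zb: "norm z < 1" using z by (simp add: approach_def)
    have D: "0 < D" using one_minus_nth_nonzero [OF zb] by (simp add: D_def)
    have r: "0 < r" using D M by (simp add: r_def)
    have p: "z + \<zeta> *s cbasis a \<in> approach a (16 * M) \<delta>'" "cmod (1 - (z + \<zeta> *s cbasis a) $ a) \<le> 2 * D"
      if "cmod \<zeta> \<le> r" for \<zeta>
      using approach_perturb_normal [OF z M, of \<delta>' \<zeta>] that by (simp_all add: \<delta>_def r_def D_def)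
    have "cmod (dG G z (cbasis a) $ a - of_real \<beta>) \<le> e * (2 * D) / r"
    \<comment> \<open>Along the disc the subtracted affine function equals
      \<open>\<beta> * (y $ a - 1)\<close>, so its slope \<open>\<beta>\<close> is the proposed
      value of the derivative.\<close>
    proof (rule directional_Cauchy_estimate [OF hol r, where c\<^sub>0 = "of_real \<beta> * (z $ a - 1)"])
      show "z + \<zeta> *s cbasis a \<in> ball 0 1" if "cmod \<zeta> \<le> r" for \<zeta>
        using p(1) [OF that] by (simp add: approach_def)
      show "cmod (G (z + \<zeta> *s cbasis a) $ a - (of_real \<beta> * (z $ a - 1) + of_real \<beta> * \<zeta>)) \<le> e * (2 * D)"
        if "cmod \<zeta> = r" for \<zeta>
      proof -
        define y where "y = z + \<zeta> *s cbasis a"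
        have y: "y \<in> approach a (16 * M) \<delta>'" "cmod (1 - y $ a) \<le> 2 * D"
          unfolding y_def using p [of \<zeta>] that by auto
        have nz: "y $ a - 1 \<noteq> 0" using one_minus_nth_nonzero [of y a] y(1) by (auto simp: approach_def)
        have "of_real \<beta> * (z $ a - 1) + of_real \<beta> * \<zeta> = of_real \<beta> * (y $ a - 1)"
          by (simp add: y_def algebra_simps)
        then have "G y $ a - (of_real \<beta> * (z $ a - 1) + of_real \<beta> * \<zeta>) = (G y $ a / (y $ a - 1) - of_real \<beta>) * (y $ a - 1)"
          using nz by (simp add: left_diff_distrib)
        then have "cmod (G y $ a - (of_real \<beta> * (z $ a - 1) + of_real \<beta> * \<zeta>)) = cmod (G y $ a / (y $ a - 1) - of_real \<beta>) * cmod (1 - y $ a)"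
          by (simp only: norm_mult norm_minus_commute [of _ 1])
        also have "\<dots> \<le> e * (2 * D)"
          using d'(2) [OF y(1)] y(2) \<epsilon> M by (intro mult_mono) (auto simp: e_def)
        finally show ?thesis by (simp add: y_def)
      qed
    qed
    also have "e * (2 * D) / r = \<epsilon> / 2" using D M by (simp add: e_def r_def)
    also have "\<dots> < \<epsilon>" using \<epsilon> by simp
    finally show ?thesis .
  qed
  moreover have "0 < \<delta>" using d' M by (simp add: \<delta>_def)
  ultimately show ?thesis by blast
qed

text \<open>The bound \<open>C * sqrt (cmod (1 - z $ a))\<close> already tends to 0, and
  \<open>\<delta>\<close> makes it smaller than \<open>\<epsilon>\<close>.\<close>

lemma dG_tangential_limit:
  assumes M: "1 \<le> M" and \<epsilon>: "0 < \<epsilon>" and j: "j \<noteq> a"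
  shows "\<exists>\<delta>>0. \<forall>z\<in>approach a M \<delta>. cmod (dG G z (cbasis j) $ a - 0) < \<epsilon>"
proof -
  obtain C where C: "0 \<le> C" "\<And>z v. z \<in> koranyi a (4 * M) \<Longrightarrow> v $ a = 0 \<Longrightarrow>
    cmod (dG G z v $ a) \<le> C * sqrt (cmod (1 - z $ a)) * norm v"
    by (rule dG_tangential_normal [of "4 * M"]) (use M in auto)
  define \<delta> where "\<delta> = min (1 / 2) ((\<epsilon> / (C + 1))\<^sup>2)"
  have "cmod (dG G z (cbasis j) $ a - 0) < \<epsilon>" if z: "z \<in> approach a M \<delta>" for z
  proof -
    have k: "z \<in> koranyi a (4 * M)" using approach_subset_koranyi [OF z _ M] by (simp add: \<delta>_def)
    have "cmod (1 - z $ a) < (\<epsilon> / (C + 1))\<^sup>2" using z by (simp add: approach_def \<delta>_def)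
    then have "sqrt (cmod (1 - z $ a)) < \<epsilon> / (C + 1)"
      using C \<epsilon> by (intro real_less_lsqrt) auto
    then have "(C + 1) * sqrt (cmod (1 - z $ a)) < \<epsilon>"
      using C by (simp add: pos_less_divide_eq mult.commute)
    moreover have "cmod (dG G z (cbasis j) $ a) \<le> C * sqrt (cmod (1 - z $ a))"
      using C(2) [OF k, of "cbasis j"] j by simp
    moreover have "0 \<le> sqrt (cmod (1 - z $ a))" by simp
    ultimately show ?thesis unfolding distrib_right diff_zero by linarith
  qed
  moreover have "0 < \<delta>" using C \<epsilon> by (simp add: \<delta>_def)
  ultimately show ?thesis by blast
qed

end

theorem theorem1p2:
  fixes G :: "complex ^ 'n::finite \<Rightarrow> complex ^ 'n" and a :: 'n
  assumes gen: "infinitesimal_generator G"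
    and H1: "bounded_on_koranyi a (\<lambda>z. cmod (cinner (G z) (cbasis a)) / cmod (z $ a - 1))"
    and H2: "\<And>j. j \<noteq> a \<Longrightarrow>
               bounded_on_koranyi a (\<lambda>z. cmod (cinner (G z) (cbasis j)) / sqrt (cmod (z $ a - 1)))"
  shows "BRNP a G \<and>
    bounded_on_koranyi a (\<lambda>z. cmod (cinner (dG G z (cbasis a)) (cbasis a))) \<and>
    (\<forall>h k. h \<noteq> a \<longrightarrow> k \<noteq> a \<longrightarrow>
       bounded_on_koranyi a (\<lambda>z. cmod (cinner (dG G z (cbasis h)) (cbasis k)))) \<and>
    (\<forall>j. j \<noteq> a \<longrightarrow>
       bounded_on_koranyi a (\<lambda>z. cmod (cinner (dG G z (cbasis j)) (cbasis a) / csqrt (1 - z $ a)))) \<and>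
    (\<forall>j. j \<noteq> a \<longrightarrow>
       bounded_on_koranyi a (\<lambda>z. cmod (csqrt (1 - z $ a) * cinner (dG G z (cbasis a)) (cbasis j)))) \<and>
    restricted_K_limit a (\<lambda>z. cinner (G z) (cbasis a) / (z $ a - 1)) (complex_of_real (dilation a G)) \<and>
    restricted_K_limit a (\<lambda>z. cinner (dG G z (cbasis a)) (cbasis a)) (complex_of_real (dilation a G)) \<and>
    (\<forall>j. j \<noteq> a \<longrightarrow> restricted_K_limit a (\<lambda>z. cinner (dG G z (cbasis j)) (cbasis a)) 0)"
proof -
  interpret koranyi_generator G a
    by unfold_locales (use gen H1 H2 in simp_all)
  have "restricted_K_limit a (\<lambda>z. G z $ a / (z $ a - 1)) (of_real \<beta>)"
    by (rule restricted_K_limitI) (metis normal_limit)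
  moreover have "restricted_K_limit a (\<lambda>z. dG G z (cbasis a) $ a) (of_real \<beta>)"
    by (rule restricted_K_limitI) (rule dG_normal_limit)
  moreover have "restricted_K_limit a (\<lambda>z. dG G z (cbasis j) $ a) 0" if "j \<noteq> a" for j
    by (rule restricted_K_limitI) (rule dG_tangential_limit [OF _ _ that])
  ultimately show ?thesis
    unfolding cinner_cbasis
    using BRNP dG_normal_normal dG_tangential_tangential dG_tangential_normal_bounded dG_normal_tangential_bounded
    by blast
qed

end
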